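(* Let $\epsilon>0$ be arbitrary. Then for $100\%$ of integral binary quartic forms $f(x,y)=f_0x^4+f_1x^3y+f_2x^2y^2+f_3xy^3+f_4y^4\in\mathbb{Z}[x,y]$ of nonzero discriminant (ordered by height $\mathrm{Ht}(f)=\max_i|f_i|$), every rational point $P=(x:y:z)\in X_f(\mathbb{Q})$ on the curve $X_f: z^2=f(x,y)$ satisfies $$h((x:y))\ \geq\ \left(\tfrac54-\epsilon\right)\log \mathrm{Ht}(f).$$
   Context: For a binary quartic form $f\in\mathbb{Z}[x,y]$ of nonzero discriminant, $X_f$ is the smooth genus-$1$ curve over $\mathbb{Q}$ given by $z^2=f(x,y)$ in the weighted projective space $\mathbb{P}(1,1,2)$ with coordinates $x,y,z$ of weights $1,1,2$. The function $h:\mathbb{P}^1(\overline{\mathbb{Q}})\to\mathbb{R}_{\ge 0}$ is the (absolute, normalized) logarithmic Weil height. Let $\mathcal{F}(X)$ be the (finite) set of integral binary quartic forms of nonzero discriminant with $\mathrm{Ht}(f)<X$. A property holds for $100\%$ of forms if the proportion of $f\in\mathcal{F}(X)$ satisfying it tends to $1$ as $X\to\infty$. *)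

theory Defs
  imports Complex_Main "HOL-Computational_Algebra.Primes"
begin

subsection \<open>Binary quartic forms\<close>

text \<open>
  \<open>Quartic a b c d e\<close> is the form $a x^4 + b x^3 y + c x^2 y^2 + d x y^3 + e y^4$.
\<close>

datatype int_quartic =
  Quartic (coeff0: int) (coeff1: int) (coeff2: int) (coeff3: int) (coeff4: int)

definition quartic_eval :: "int_quartic \<Rightarrow> 'a::comm_ring_1 \<Rightarrow> 'a \<Rightarrow> 'a" where
  "quartic_eval f x y =
     of_int (coeff0 f) * x ^ 4 + of_int (coeff1 f) * x ^ 3 * y + of_int (coeff2 f) * x ^ 2 * y ^ 2
     + of_int (coeff3 f) * x * y ^ 3 + of_int (coeff4 f) * y ^ 4"

definition quartic_height :: "int_quartic \<Rightarrow> int" where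
  "quartic_height f =
     Max {\<bar>coeff0 f\<bar>, \<bar>coeff1 f\<bar>, \<bar>coeff2 f\<bar>, \<bar>coeff3 f\<bar>, \<bar>coeff4 f\<bar>}"

text \<open>
  The discriminant of the binary form (not of a dehomogenised polynomial), so that it also makes
  sense when the leading coefficient vanishes. The normalisation is the usual one,
  see \<open>quartic_discr_linear_factors\<close> and \<open>quartic_discr_invariants\<close>.
\<close>

definition quartic_discr :: "'a::comm_ring_1 \<Rightarrow> 'a \<Rightarrow> 'a \<Rightarrow> 'a \<Rightarrow> 'a \<Rightarrow> 'a" where
  "quartic_discr a b c d e =
     256 * a^3 * e^3 - 192 * a^2 * b * d * e^2 - 128 * a^2 * c^2 * e^2 + 144 * a^2 * c * d^2 * e
     - 27 * a^2 * d^4 + 144 * a * b^2 * c * e^2 - 6 * a * b^2 * d^2 * e - 80 * a * b * c^2 * d * e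
     + 18 * a * b * c * d^3 + 16 * a * c^4 * e - 4 * a * c^3 * d^2 - 27 * b^4 * e^2
     + 18 * b^3 * c * d * e - 4 * b^3 * d^3 - 4 * b^2 * c^3 * e + b^2 * c^2 * d^2"

definition discriminant :: "int_quartic \<Rightarrow> int" where
  "discriminant f = quartic_discr (coeff0 f) (coeff1 f) (coeff2 f) (coeff3 f) (coeff4 f)"

lemma quartic_discr_invariants:
  fixes a b c d e :: "'a::idom"
  shows "27 * quartic_discr a b c d e =
    4 * (12*a*e - 3*b*d + c^2)^3 - (72*a*c*e + 9*b*c*d - 27*a*d^2 - 27*e*b^2 - 2*c^3)^2"
  unfolding quartic_discr_def by algebra

lemma quartic_discr_quadratic_factors:
  fixes p q r s t u :: "'a::idom"
  shows "quartic_discr (p*s) (p*t + q*s) (p*u + q*t + r*s) (q*u + r*t) (r*u) =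
    (q^2 - 4*p*r) * (t^2 - 4*s*u) * ((p*u - s*r)^2 - (p*t - s*q) * (q*u - t*r))^2"
  unfolding quartic_discr_def by algebra

lemma quartic_discr_linear_factors:
  fixes a1 a2 a3 a4 b1 b2 b3 b4 :: "'a::idom"
  defines "a \<equiv> a1 * a2 * a3 * a4"
    and "b \<equiv> - (b1*a2*a3*a4 + a1*b2*a3*a4 + a1*a2*b3*a4 + a1*a2*a3*b4)"
    and "c \<equiv> b1*b2*a3*a4 + b1*a2*b3*a4 + b1*a2*a3*b4 + a1*b2*b3*a4 + a1*b2*a3*b4 + a1*a2*b3*b4"
    and "d \<equiv> - (a1*b2*b3*b4 + b1*a2*b3*b4 + b1*b2*a3*b4 + b1*b2*b3*a4)"
    and "e \<equiv> b1 * b2 * b3 * b4"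
  shows "a * x^4 + b * x^3 * y + c * x^2 * y^2 + d * x * y^3 + e * y^4 =
           (a1*x - b1*y) * (a2*x - b2*y) * (a3*x - b3*y) * (a4*x - b4*y)"
    and "quartic_discr a b c d e =
           ((a1*b2 - a2*b1) * (a1*b3 - a3*b1) * (a1*b4 - a4*b1)
            * (a2*b3 - a3*b2) * (a2*b4 - a4*b2) * (a3*b4 - a4*b3))^2"
proof -
  show "a * x^4 + b * x^3 * y + c * x^2 * y^2 + d * x * y^3 + e * y^4 =
           (a1*x - b1*y) * (a2*x - b2*y) * (a3*x - b3*y) * (a4*x - b4*y)"
    unfolding assms by algebra
  define p q r s t u where "p = a1*a2" and "q = - (a1*b2 + a2*b1)" and "r = b1*b2"
    and "s = a3*a4" and "t = - (a3*b4 + a4*b3)" and "u = b3*b4"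
  note pq = this
  have "a = p*s" "b = p*t + q*s" "c = p*u + q*t + r*s" "d = q*u + r*t" "e = r*u"
    unfolding assms pq by algebra+
  then have "quartic_discr a b c d e =
      (q^2 - 4*p*r) * (t^2 - 4*s*u) * ((p*u - s*r)^2 - (p*t - s*q) * (q*u - t*r))^2"
    by (simp only: quartic_discr_quadratic_factors)
  also have "q^2 - 4*p*r = (a1*b2 - a2*b1)^2"
    unfolding pq by algebra
  also have "t^2 - 4*s*u = (a3*b4 - a4*b3)^2"
    unfolding pq by algebra
  also have "(p*u - s*r)^2 - (p*t - s*q) * (q*u - t*r) =
      (a1*b3 - a3*b1) * (a1*b4 - a4*b1) * (a2*b3 - a3*b2) * (a2*b4 - a4*b2)"
    unfolding pq by algebra
  finally show "quartic_discr a b c d e =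
           ((a1*b2 - a2*b1) * (a1*b3 - a3*b1) * (a1*b4 - a4*b1)
            * (a2*b3 - a3*b2) * (a2*b4 - a4*b2) * (a3*b4 - a4*b3))^2"
    by (simp add: power_mult_distrib mult_ac)
qed

definition forms_below :: "real \<Rightarrow> int_quartic set" where
  "forms_below X = {f. discriminant f \<noteq> 0 \<and> real_of_int (quartic_height f) < X}"

lemma finite_forms_below: "finite (forms_below X)"
proof -
  let ?I = "{- \<lceil>X\<rceil>..\<lceil>X\<rceil>}"
  let ?q = "\<lambda>(a, b, c, d, e). Quartic a b c d e"
  have "forms_below X \<subseteq> ?q ` (?I \<times> ?I \<times> ?I \<times> ?I \<times> ?I)"
  proof
    fix f assume "f \<in> forms_below X"
    then have "quartic_height f \<le> \<lceil>X\<rceil>"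
      unfolding forms_below_def by (simp add: le_ceiling_iff)
    then show "f \<in> ?q ` (?I \<times> ?I \<times> ?I \<times> ?I \<times> ?I)"
      by (cases f) (auto simp: quartic_height_def abs_le_iff image_iff minus_le_iff)
  qed
  then show ?thesis
    by (rule finite_subset) auto
qed

definition holds_for_100_percent :: "(int_quartic \<Rightarrow> bool) \<Rightarrow> bool" where
  "holds_for_100_percent Q \<longleftrightarrow>
     ((\<lambda>X::real. real (card {f \<in> forms_below X. Q f}) / real (card (forms_below X)))
        \<longlongrightarrow> 1) at_top"


subsection \<open>Rational points on the genus one curve\<close>

text \<open>
  Points of $X_f(\mathbb{Q})$ are given by their rational homogeneous coordinates
  $(x : y : z)$ of weights $1, 1, 2$: the set below is the set of all coordinate triples, stable
  under $(x, y, z) \mapsto (t x, t y, t^2 z)$. Every rational point of $X_f$ has rational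
  coordinates because $x$ or $y$ is nonzero on $X_f$ and can be scaled to $1$.
\<close>

definition rational_points :: "int_quartic \<Rightarrow> (rat \<times> rat \<times> rat) set" where
  "rational_points f = {(x, y, z). (x, y, z) \<noteq> (0, 0, 0) \<and> z\<^sup>2 = quartic_eval f x y}"

lemma rational_points_scale:
  assumes "(x, y, z) \<in> rational_points f" "t \<noteq> 0"
  shows "(t * x, t * y, t\<^sup>2 * z) \<in> rational_points f"
proof -
  have "quartic_eval f (t * x) (t * y) = t ^ 4 * quartic_eval f x y"
    unfolding quartic_eval_def by algebra
  moreover have "(t\<^sup>2 * z)\<^sup>2 = t ^ 4 * z\<^sup>2"
    by algebra
  ultimately show ?thesis
    using assms by (auto simp: rational_points_def)
qed

lemma rational_points_xy_nonzero:
  assumes "(x, y, z) \<in> rational_points f"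
  shows "x \<noteq> 0 \<or> y \<noteq> 0"
  using assms by (auto simp: rational_points_def quartic_eval_def)


subsection \<open>The Weil height on the rational projective line\<close>

definition padic_abs :: "nat \<Rightarrow> rat \<Rightarrow> real" where
  "padic_abs p r =
     (if r = 0 then 0
      else real p powi (int (multiplicity (int p) (snd (quotient_of r)))
                        - int (multiplicity (int p) (fst (quotient_of r)))))"

text \<open>
  The absolute logarithmic Weil height of the point $(x : y)$, as a sum of local contributions over
  the places of $\mathbb{Q}$. Only finitely many primes contribute (\<open>finite_local_heights\<close>),
  and the value does not depend on the choice of coordinates (\<open>weil_height_scale\<close>).
\<close>

definition weil_height :: "rat \<Rightarrow> rat \<Rightarrow> real" where
  "weil_height x y =
     ln (max \<bar>of_rat x\<bar> \<bar>of_rat y\<bar>)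
     + (\<Sum>p | prime p \<and> max (padic_abs p x) (padic_abs p y) \<noteq> 1.
          ln (max (padic_abs p x) (padic_abs p y)))"

lemma padic_abs_0 [simp]: "padic_abs p 0 = 0"
  by (simp add: padic_abs_def)

lemma padic_abs_pos: "prime p \<Longrightarrow> r \<noteq> 0 \<Longrightarrow> padic_abs p r > 0"
  by (auto simp: padic_abs_def prime_gt_0_nat)

lemma padic_abs_nonneg: "padic_abs p r \<ge> 0"
  by (simp add: padic_abs_def)

lemma padic_abs_of_int_div:
  assumes p: "prime p" and "a \<noteq> 0" "b \<noteq> 0"
  shows "padic_abs p (of_int a / of_int b) =
           real p powi (int (multiplicity (int p) b) - int (multiplicity (int p) a))"
proof -
  obtain n d where q: "quotient_of (of_int a / of_int b) = (n, d)"
    by fastforce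
  have "d > 0"
    using q by (rule quotient_of_denom_pos)
  have eq: "(of_int a / of_int b :: rat) = of_int n / of_int d"
    using q by (rule quotient_of_div)
  with assms \<open>d > 0\<close> have "n \<noteq> 0"
    by auto
  have "(of_int (a * d) :: rat) = of_int (n * b)"
    using eq assms \<open>d > 0\<close> by (simp add: field_simps)
  then have "a * d = n * b"
    by (simp only: of_int_eq_iff)
  moreover have pe: "prime_elem (int p)"
    using p by simp
  ultimately have
    "multiplicity (int p) a + multiplicity (int p) d = multiplicity (int p) n + multiplicity (int p) b"
    using assms \<open>d > 0\<close> \<open>n \<noteq> 0\<close>
    by (metis prime_elem_multiplicity_mult_distrib less_irrefl)
  then have "int (multiplicity (int p) d) - int (multiplicity (int p) n)
      = int (multiplicity (int p) b) - int (multiplicity (int p) a)"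
    by linarith
  then show ?thesis
    using assms q by (simp add: padic_abs_def)
qed

lemma rat_fraction_cases:
  obtains a b where "(r::rat) = of_int a / of_int b" "b \<noteq> 0" "r \<noteq> 0 \<longrightarrow> a \<noteq> 0"
proof -
  obtain n d where "quotient_of r = (n, d)"
    by fastforce
  then have "r = of_int n / of_int d" "d > 0"
    by (auto dest: quotient_of_div quotient_of_denom_pos)
  then show ?thesis
    using that[of n d] by auto
qed

lemma padic_abs_mult:
  assumes p: "prime p"
  shows "padic_abs p (r * s) = padic_abs p r * padic_abs p s"
proof (cases "r = 0 \<or> s = 0")
  case False
  obtain a b where r: "r = of_int a / of_int b" "b \<noteq> 0" "a \<noteq> 0"
    using False by (metis rat_fraction_cases)
  obtain c d where s: "s = of_int c / of_int d" "d \<noteq> 0" "c \<noteq> 0"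
    using False by (metis rat_fraction_cases)
  have rs: "r * s = of_int (a * c) / of_int (b * d)"
    using r s by simp
  have pe: "prime_elem (int p)" and p0: "real p \<noteq> 0"
    using p by (auto simp: prime_gt_0_nat)
  have "padic_abs p (r * s) = real p powi
      ((int (multiplicity (int p) b) - int (multiplicity (int p) a))
       + (int (multiplicity (int p) d) - int (multiplicity (int p) c)))"
    unfolding rs using r s pe
    by (simp add: padic_abs_of_int_div[OF p] prime_elem_multiplicity_mult_distrib algebra_simps
             del: of_int_mult)
  also have "\<dots> = padic_abs p r * padic_abs p s"
    unfolding r s using r s p0 by (simp add: padic_abs_of_int_div[OF p] power_int_add)
  finally show ?thesis .
qed auto

lemma finite_padic_abs_ne_1:
  assumes "r \<noteq> 0"
  shows "finite {p. prime p \<and> padic_abs p r \<noteq> 1}"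
proof -
  obtain a b where r: "r = of_int a / of_int b" "b \<noteq> 0" "a \<noteq> 0"
    using assms by (metis rat_fraction_cases)
  have "{p. prime p \<and> padic_abs p r \<noteq> 1} \<subseteq> {..nat \<bar>a\<bar>} \<union> {..nat \<bar>b\<bar>}"
  proof
    fix p assume "p \<in> {p. prime p \<and> padic_abs p r \<noteq> 1}"
    then have p: "prime p" and ne: "padic_abs p r \<noteq> 1"
      by auto
    have "int p dvd a \<or> int p dvd b"
    proof (rule ccontr)
      assume "\<not> ?thesis"
      then have "multiplicity (int p) a = 0" "multiplicity (int p) b = 0"
        by (auto intro: not_dvd_imp_multiplicity_0)
      then show False
        using ne r by (simp add: padic_abs_of_int_div[OF p])
    qed
    then show "p \<in> {..nat \<bar>a\<bar>} \<union> {..nat \<bar>b\<bar>}"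
      using r by (auto dest!: dvd_imp_le_int)
  qed
  then show ?thesis
    by (rule finite_subset) auto
qed

lemma finite_local_heights:
  assumes "x \<noteq> 0 \<or> y \<noteq> 0"
  shows "finite {p. prime p \<and> max (padic_abs p x) (padic_abs p y) \<noteq> 1}"
proof -
  have "{p. prime p \<and> max (padic_abs p x) (padic_abs p y) \<noteq> 1}
      \<subseteq> (if x = 0 then {} else {p. prime p \<and> padic_abs p x \<noteq> 1})
        \<union> (if y = 0 then {} else {p. prime p \<and> padic_abs p y \<noteq> 1})"
    using assms by (auto simp: max_def padic_abs_nonneg split: if_splits)
  then show ?thesis
    by (rule finite_subset) (auto simp: finite_padic_abs_ne_1)
qed

lemma ln_abs_int_conv_multiplicity:
  assumes "a \<noteq> 0" "finite S" "\<And>p. p \<in> S \<Longrightarrow> prime p"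
    "\<And>p. prime p \<Longrightarrow> int p dvd a \<Longrightarrow> p \<in> S"
  shows "ln \<bar>real_of_int a\<bar> = (\<Sum>p\<in>S. real (multiplicity (int p) a) * ln (real p))"
proof -
  define n where "n = nat \<bar>a\<bar>"
  have n: "n \<noteq> 0" "int n = \<bar>a\<bar>"
    using assms by (auto simp: n_def)
  have mult: "multiplicity (int p) a = multiplicity p n" if "prime p" for p
  proof -
    have "multiplicity (int p) a = multiplicity (int p) (int n)"
      using n by (metis multiplicity_normalize_right normalize_int_def)
    also have "\<dots> = multiplicity p n"
      unfolding multiplicity_def by (simp flip: of_nat_power)
    finally show ?thesis .
  qed
  have "n = (\<Prod>p\<in>prime_factors n. p ^ multiplicity p n)"
    using n prime_factorization_nat by blast
  also have "\<dots> = (\<Prod>p\<in>S. p ^ multiplicity p n)"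
  proof (rule prod.mono_neutral_left)
    show "finite S" by fact
    show "prime_factors n \<subseteq> S"
    proof
      fix p assume "p \<in> prime_factors n"
      then have "prime p" "int p dvd int n"
        by (auto simp: in_prime_factors_iff)
      then show "p \<in> S"
        using assms(4) n by simp
    qed
    show "\<forall>p\<in>S - prime_factors n. p ^ multiplicity p n = 1"
      using assms(3) n by (auto simp: prime_factors_multiplicity)
  qed
  finally have "real n = (\<Prod>p\<in>S. real p ^ multiplicity p n)"
    by (metis (no_types, lifting) of_nat_power of_nat_prod prod.cong)
  then have "ln (real n) = (\<Sum>p\<in>S. ln (real p ^ multiplicity p n))"
    using assms(2,3) by (simp add: ln_prod prime_gt_0_nat)
  also have "\<dots> = (\<Sum>p\<in>S. real (multiplicity (int p) a) * ln (real p))"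
    using assms(3) by (intro sum.cong) (auto simp: mult ln_realpow prime_gt_0_nat)
  also have "real n = \<bar>real_of_int a\<bar>"
    using n by (metis of_int_abs of_int_of_nat_eq)
  finally show ?thesis .
qed

lemma product_formula:
  assumes r: "r \<noteq> 0" and S: "finite S" "\<And>p. p \<in> S \<Longrightarrow> prime p"
    "\<And>p. prime p \<Longrightarrow> padic_abs p r \<noteq> 1 \<Longrightarrow> p \<in> S"
  shows "ln \<bar>real_of_rat r\<bar> + (\<Sum>p\<in>S. ln (padic_abs p r)) = 0"
proof -
  obtain a b where ab: "r = of_int a / of_int b" "b \<noteq> 0" "a \<noteq> 0"
    using r by (metis rat_fraction_cases)
  define T where "T = S \<union> {p. prime p \<and> (int p dvd a \<or> int p dvd b)}"
  have "{p. prime p \<and> (int p dvd a \<or> int p dvd b)} \<subseteq> {..nat \<bar>a\<bar>} \<union> {..nat \<bar>b\<bar>}"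
    using ab by (auto dest!: dvd_imp_le_int)
  then have "finite {p. prime p \<and> (int p dvd a \<or> int p dvd b)}"
    by (rule finite_subset) auto
  then have T: "finite T" "\<And>p. p \<in> T \<Longrightarrow> prime p"
    using S by (auto simp: T_def)
  have lnp: "ln (padic_abs p r) =
      real (multiplicity (int p) b) * ln (real p) - real (multiplicity (int p) a) * ln (real p)"
    if "prime p" for p
    unfolding ab(1) padic_abs_of_int_div[OF that ab(3,2)]
    using prime_gt_0_nat[OF that] by (simp add: power_int_diff ln_div ln_realpow)
  have "(\<Sum>p\<in>S. ln (padic_abs p r)) = (\<Sum>p\<in>T. ln (padic_abs p r))"
  proof (rule sum.mono_neutral_left)
    show "\<forall>p\<in>T - S. ln (padic_abs p r) = 0"
      using T S(3) by (metis DiffD1 DiffD2 ln_one)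
    show "finite T"
      by (rule T(1))
    show "S \<subseteq> T"
      by (simp add: T_def)
  qed
  also have "\<dots> = (\<Sum>p\<in>T. real (multiplicity (int p) b) * ln (real p))
      - (\<Sum>p\<in>T. real (multiplicity (int p) a) * ln (real p))"
    using T by (simp add: lnp sum_subtractf)
  also have "\<dots> = ln \<bar>real_of_int b\<bar> - ln \<bar>real_of_int a\<bar>"
  proof -
    have "ln \<bar>real_of_int c\<bar> = (\<Sum>p\<in>T. real (multiplicity (int p) c) * ln (real p))"
      if "c = a \<or> c = b" for c
    proof (rule ln_abs_int_conv_multiplicity)
      show "c \<noteq> 0"
        using that ab by blast
      show "p \<in> T" if "prime p" "int p dvd c" for p
        using that \<open>c = a \<or> c = b\<close> by (auto simp: T_def)
    qed (use T in auto)
    then show ?thesis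
      by simp
  qed
  also have "ln \<bar>real_of_int b\<bar> - ln \<bar>real_of_int a\<bar> = - ln \<bar>real_of_rat r\<bar>"
    using ab by (simp add: of_rat_divide ln_div)
  finally show ?thesis
    by simp
qed

lemma weil_height_eq_sum:
  assumes xy: "x \<noteq> 0 \<or> y \<noteq> 0" and S: "finite S" "\<And>p. p \<in> S \<Longrightarrow> prime p"
    "\<And>p. prime p \<Longrightarrow> max (padic_abs p x) (padic_abs p y) \<noteq> 1 \<Longrightarrow> p \<in> S"
  shows "weil_height x y = ln (max \<bar>of_rat x\<bar> \<bar>of_rat y\<bar>)
           + (\<Sum>p\<in>S. ln (max (padic_abs p x) (padic_abs p y)))"
proof -
  have "(\<Sum>p | prime p \<and> max (padic_abs p x) (padic_abs p y) \<noteq> 1.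
          ln (max (padic_abs p x) (padic_abs p y)))
      = (\<Sum>p\<in>S. ln (max (padic_abs p x) (padic_abs p y)))"
    using S by (intro sum.mono_neutral_left) auto
  then show ?thesis
    by (simp add: weil_height_def)
qed

lemma weil_height_scale:
  assumes xy: "x \<noteq> 0 \<or> y \<noteq> 0" and t: "t \<noteq> 0"
  shows "weil_height (t * x) (t * y) = weil_height x y"
proof -
  let ?m = "\<lambda>p. max (padic_abs p x) (padic_abs p y)"
  define S where "S = {p. prime p \<and> ?m p \<noteq> 1} \<union> {p. prime p \<and> padic_abs p t \<noteq> 1}"
  have S: "finite S" "\<And>p. p \<in> S \<Longrightarrow> prime p"
    using finite_local_heights[OF xy] finite_padic_abs_ne_1[OF t] by (auto simp: S_def)
  have m: "max (padic_abs p (t * x)) (padic_abs p (t * y)) = padic_abs p t * ?m p"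
    if "prime p" for p
    using that by (simp add: padic_abs_mult max_mult_distrib_left padic_abs_nonneg)
  have m_pos: "?m p > 0" if "prime p" for p
    using that xy padic_abs_pos[of p x] padic_abs_pos[of p y] by (auto simp: less_max_iff_disj)
  have "weil_height (t * x) (t * y) =
      ln (max \<bar>of_rat (t * x)\<bar> \<bar>of_rat (t * y)\<bar>) + (\<Sum>p\<in>S. ln (padic_abs p t * ?m p))"
  proof (subst weil_height_eq_sum[of _ _ S])
    show "p \<in> S" if "prime p" "max (padic_abs p (t * x)) (padic_abs p (t * y)) \<noteq> 1" for p
      using that m[of p] by (auto simp: S_def)
    have "(\<Sum>p\<in>S. ln (max (padic_abs p (t * x)) (padic_abs p (t * y)))) =
        (\<Sum>p\<in>S. ln (padic_abs p t * ?m p))"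
      using S m by (intro sum.cong) auto
    then show "ln (max \<bar>of_rat (t * x)\<bar> \<bar>of_rat (t * y)\<bar>)
        + (\<Sum>p\<in>S. ln (max (padic_abs p (t * x)) (padic_abs p (t * y)))) =
      ln (max \<bar>of_rat (t * x)\<bar> \<bar>of_rat (t * y)\<bar>) + (\<Sum>p\<in>S. ln (padic_abs p t * ?m p))"
      by simp
  qed (use xy t S in auto)
  also have "(\<Sum>p\<in>S. ln (padic_abs p t * ?m p)) =
      (\<Sum>p\<in>S. ln (padic_abs p t)) + (\<Sum>p\<in>S. ln (?m p))"
    unfolding sum.distrib[symmetric]
  proof (rule sum.cong)
    fix p assume "p \<in> S"
    then show "ln (padic_abs p t * ?m p) = ln (padic_abs p t) + ln (?m p)"
      by (intro ln_mult_pos m_pos padic_abs_pos S(2) t)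
  qed simp
  also have "ln (max \<bar>of_rat (t * x)\<bar> \<bar>of_rat (t * y)\<bar> :: real) =
      ln \<bar>of_rat t\<bar> + ln (max \<bar>of_rat x\<bar> \<bar>of_rat y\<bar>)"
  proof -
    have "max \<bar>of_rat (t * x)\<bar> \<bar>of_rat (t * y)\<bar> =
        \<bar>of_rat t :: real\<bar> * max \<bar>of_rat x\<bar> \<bar>of_rat y\<bar>"
      by (simp add: of_rat_mult abs_mult max_mult_distrib_left)
    moreover have "max \<bar>of_rat x\<bar> \<bar>of_rat y\<bar> > (0::real)"
      using xy by (auto simp: less_max_iff_disj)
    ultimately show ?thesis
      using t by (simp add: ln_mult_pos)
  qed
  also have "ln \<bar>of_rat t\<bar> + ln (max \<bar>of_rat x\<bar> \<bar>of_rat y\<bar>)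
      + ((\<Sum>p\<in>S. ln (padic_abs p t)) + (\<Sum>p\<in>S. ln (?m p)))
      = ln (max \<bar>of_rat x\<bar> \<bar>of_rat y\<bar>) + (\<Sum>p\<in>S. ln (?m p))"
  proof -
    have "ln \<bar>real_of_rat t\<bar> + (\<Sum>p\<in>S. ln (padic_abs p t)) = 0"
      by (rule product_formula[OF t S]) (auto simp: S_def)
    then show ?thesis
      by linarith
  qed
  also have "\<dots> = weil_height x y"
    by (rule weil_height_eq_sum[OF xy S, symmetric]) (auto simp: S_def)
  finally show ?thesis .
qed

lemma weil_height_coprime:
  assumes "coprime a b"
  shows "weil_height (of_int a) (of_int b) = ln (real_of_int (max \<bar>a\<bar> \<bar>b\<bar>))"
proof -
  have int_val: "padic_abs p (of_int c) = (if c = 0 then 0 else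
      real p powi (- int (multiplicity (int p) c)))" if "prime p" for p c
    using padic_abs_of_int_div[OF that, of c 1] by simp
  have le1: "padic_abs p (of_int c) \<le> 1" if "prime p" for p c
    using prime_ge_1_nat[OF that]
    by (simp add: int_val[OF that] power_int_minus inverse_le_1_iff)
  have eq1: "padic_abs p (of_int c) = 1" if "prime p" "\<not> int p dvd c" for p c
    using that by (auto simp: int_val not_dvd_imp_multiplicity_0)
  have "max (padic_abs p (of_int a)) (padic_abs p (of_int b)) = 1" if p: "prime p" for p
  proof -
    have "\<not> int p dvd a \<or> \<not> int p dvd b"
      using assms p by (metis coprime_common_divisor not_prime_unit prime_nat_int_transfer)
    then show ?thesis
      using eq1[OF p] le1[OF p] by (auto simp: max_def intro: antisym)
  qed
  then have "{p. prime p \<and> max (padic_abs p (of_int a)) (padic_abs p (of_int b)) \<noteq> 1} = {}"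
    by auto
  then show ?thesis
    by (simp add: weil_height_def of_int_max)
qed

end

theory Submission
  imports Defs "HOL-Analysis.Harmonic_Numbers" "HOL-Real_Asymp.Real_Asymp"
begin

text \<open>The exponent 5/4 comes from the summand 1 in \<open>(X/a+1)^2\<close>. Beyond
  \<open>a = X\<close> a residue class modulo \<open>a\<close> keeps only O(1) coefficients, so each
  of the roughly M^2 points with \<open>a \<le> M\<close> costs X^(5/2+o(1)); the total stays below
  X^5 exactly while M is below X^(5/4). The summands X^2/a^2 add up to X^2 log X only, which
  contributes X^(9/2+o(1)). The obstacle is that z^2 = c modulo a^2 can have about g times the usual
  number of roots when g^2 divides both a^2 and 4c. Here g divides \<open>a\<close>, and as
  \<open>a\<close> and \<open>b\<close> are coprime, for fixed f_3 the condition on c restricts f_4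
  to O(X/g^2 + 1) values. Weighted with g this is O(X/g + g), which is harmless only if g = O(X). A
  nonzero f_4 ensures that, because g then divides 4 f_4; for f_4 = 0 this bound on g is lost. The
  O(X^4) forms with f_0 = 0 or f_4 = 0 are therefore set aside, both ends being affected since the
  symmetry exchanges them.\<close>

text \<open>
  A form violating the bound takes a square value $z^2 = f(a,b)$ at some coprime $(a,b)$ with
  $\max(|a|,|b|) \le X^{5/4-\epsilon}$; by symmetry let $|b| \le a$. For fixed $(a,b)$ there are
  $O(X^2)$ choices of $(f_3,f_4)$. They determine $z^2$ modulo $a^2$, and since
  $z = O(X^{1/2} a^2)$ there are on average only $O(X^{1/2} \tau(a^2))$ such $z$, provided that
  $f_4 \ne 0$. Then $f_2$ and $f_1$ are each determined modulo $a$, and $f_0$ is determined. Summing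
  the resulting $X^{5/2+o(1)} (X/a+1)^2$ over $|b| \le a \le X^{5/4-\epsilon}$ gives $o(X^5)$.
\<close>

subsection \<open>Square roots modulo an integer\<close>

lemma card_congruent_le:
  fixes S :: "int set" and m :: nat
  assumes "m > 0" "S \<subseteq> {u..v}" "u \<le> v"
    and cong: "\<And>x y. x \<in> S \<Longrightarrow> y \<in> S \<Longrightarrow> int m dvd x - y"
  shows "real (card S) \<le> real_of_int (v - u) / real m + 1"
proof -
  let ?h = "\<lambda>x. (x - u) div int m"
  have "inj_on ?h S"
  proof
    fix x y assume xy: "x \<in> S" "y \<in> S" "?h x = ?h y"
    then have "(x - u) mod int m = (y - u) mod int m"
      using cong[OF xy(1,2)] by (simp add: mod_eq_dvd_iff)
    with xy(3) show "x = y"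
      by (metis diff_add_cancel div_mult_mod_eq)
  qed
  moreover have "?h ` S \<subseteq> {0..(v - u) div int m}"
    using assms(1,2) by (fastforce intro: zdiv_mono1 simp: pos_imp_zdiv_nonneg_iff)
  ultimately have "card S \<le> card {0..(v - u) div int m}"
    by (intro card_inj_on_le) auto
  then have "real (card S) \<le> real_of_int ((v - u) div int m + 1)"
    using assms(1,3) by (simp add: pos_imp_zdiv_nonneg_iff le_nat_iff)
  also have "\<dots> \<le> real_of_int (v - u) / real m + 1"
    using real_of_int_div4[of "v - u" "int m"] by simp
  finally show ?thesis .
qed

lemma gcd_codivisor_square_dvd:
  fixes d n :: nat
  assumes "d dvd n"
  shows "(gcd d (n div d))\<^sup>2 dvd n"
proof -
  have "gcd d (n div d) * gcd d (n div d) dvd d * (n div d)"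
    by (intro mult_dvd_mono) auto
  then show ?thesis
    using assms by (simp add: power2_eq_square)
qed

text \<open>
  Two square roots \<open>z\<close>, \<open>z0\<close> of \<open>c\<close> modulo \<open>n\<close> satisfy \<open>n dvd (z - z0) * (z + z0)\<close>; with
  \<open>d = gcd (z - z0) n\<close> the root \<open>z\<close> is then determined modulo \<open>lcm d (n div d)\<close>.
\<close>

lemma card_square_roots_mod_le:
  fixes n :: nat and c Z :: int
  assumes "n > 0" "Z \<ge> 0"
  shows "real (card {z \<in> {0..Z}. int n dvd z\<^sup>2 - c})
    \<le> (\<Sum>d | d dvd n \<and> int ((gcd d (n div d))\<^sup>2) dvd 4 * c.
          real (gcd d (n div d)) * real_of_int Z / real n + 1)"
proof -
  let ?S = "{z \<in> {0..Z}. int n dvd z\<^sup>2 - c}"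
  let ?D = "{d. d dvd n \<and> int ((gcd d (n div d))\<^sup>2) dvd 4 * c}"
  let ?g = "\<lambda>d. gcd d (n div d)"
  have finD: "finite ?D"
    using assms by simp
  show ?thesis
  proof (cases "?S = {}")
    case True
    show ?thesis
      unfolding True using assms by (auto intro!: sum_nonneg)
  next
    case False
    then obtain z0 where z0: "z0 \<in> ?S"
      by blast
    define F where "F d = {z \<in> ?S. gcd (z - z0) (int n) = int d}" for d
    have finF: "finite (F d)" for d
      by (rule finite_subset[of _ "{0..Z}"]) (auto simp: F_def)
    have codvd: "int (n div d) dvd z + z0" "int d dvd z - z0" "d dvd n" if z: "z \<in> F d" for d z
    proof -
      have gd: "gcd (z - z0) (int n) = int d" and zS: "z \<in> ?S"
        using z by (auto simp: F_def)
      have "int d dvd int n"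
        using gd by (metis gcd_dvd2)
      then show dn: "d dvd n"
        by simp
      then have "d > 0"
        using assms by (auto intro: Nat.gr0I)
      show dz: "int d dvd z - z0"
        using gd by (metis gcd_dvd1)
      then obtain k where k: "z - z0 = int d * k"
        by blast
      from dn obtain e where e: "n = d * e"
        by blast
      have "int d * gcd k (int e) = int d"
        using gd unfolding k e by (simp add: gcd_mult_left)
      then have "coprime (int e) k"
        using \<open>d > 0\<close> by (simp add: coprime_iff_gcd_eq_1 gcd.commute)
      moreover have "int n dvd (z - z0) * (z + z0)"
      proof -
        have "int n dvd (z\<^sup>2 - c) - (z0\<^sup>2 - c)"
          using zS z0 by (intro dvd_diff[of _ "z\<^sup>2 - c"]) simp_all
        also have "(z\<^sup>2 - c) - (z0\<^sup>2 - c) = (z - z0) * (z + z0)"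
          by algebra
        finally show ?thesis .
      qed
      then have "int e dvd k * (z + z0)"
        using \<open>d > 0\<close> by (simp add: k e mult.assoc)
      ultimately have "int e dvd z + z0"
        by (simp add: coprime_dvd_mult_right_iff)
      then show "int (n div d) dvd z + z0"
        using e \<open>d > 0\<close> by simp
    qed
    have "?S \<subseteq> (\<Union>d\<in>?D. F d)"
    proof
      fix z assume z: "z \<in> ?S"
      define d where "d = nat (gcd (z - z0) (int n))"
      have zF: "z \<in> F d"
        using z by (simp add: F_def d_def)
      \<comment> \<open>Origin of the filter in the sum: \<open>?g d\<close> divides both
        \<open>z - z0\<close> and \<open>z + z0\<close>, hence \<open>2 * z0\<close>. Its square
        divides \<open>n\<close>, so \<open>z0\<close> may be replaced by a square root of
        \<open>c\<close> modulo that square, and the factor 2 becomes the 4 in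
        \<open>4 * c\<close>.\<close>
      have "int (?g d) dvd (z + z0) - (z - z0)"
        by (intro dvd_diff[OF dvd_trans[OF _ codvd(1)[OF zF]] dvd_trans[OF _ codvd(2)[OF zF]]])
          (simp_all only: int_dvd_int_iff gcd_dvd1 gcd_dvd2)
      then have "int (?g d) dvd 2 * z0"
        by simp
      then have "(int (?g d))\<^sup>2 dvd (2 * z0)\<^sup>2"
        by (rule dvd_power_same)
      then have *: "int ((?g d)\<^sup>2) dvd 4 * z0\<^sup>2"
        by (simp add: power_mult_distrib)
      have "int ((?g d)\<^sup>2) dvd int n"
        using gcd_codivisor_square_dvd[OF codvd(3)[OF zF]] by (simp only: int_dvd_int_iff)
      then have "int ((?g d)\<^sup>2) dvd 4 * (z0\<^sup>2 - c)"
        using z0 by (intro dvd_mult) (auto intro: dvd_trans)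
      from dvd_diff[OF * this] have "int ((?g d)\<^sup>2) dvd 4 * c"
        by (simp add: algebra_simps)
      then show "z \<in> (\<Union>d\<in>?D. F d)"
        using zF codvd(3)[OF zF] by auto
    qed
    then have "card ?S \<le> card (\<Union>d\<in>?D. F d)"
      by (rule card_mono[OF finite_UN_I[OF finD finF]])
    also have "\<dots> \<le> (\<Sum>d\<in>?D. card (F d))"
      by (rule card_UN_le[OF finD])
    finally have "real (card ?S) \<le> (\<Sum>d\<in>?D. real (card (F d)))"
      by (simp only: of_nat_sum[symmetric] of_nat_le_iff)
    also have "\<dots> \<le> (\<Sum>d\<in>?D. real (?g d) * real_of_int Z / real n + 1)"
    proof (rule sum_mono)
      fix d assume "d \<in> ?D"
      then have dn: "d dvd n"
        by simp
      \<comment> \<open>Since gcd times lcm is \<open>n\<close>, the modulus that pins down the root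
        is \<open>n\<close> divided by \<open>?g d\<close>; this loss is the weight in the
        sum.\<close>
      let ?m = "lcm d (n div d)"
      have gm: "?g d * ?m = n"
        using prod_gcd_lcm_nat[of d "n div d"] dn by simp
      then have "?g d * ?m > 0"
        using assms(1) by (simp only:)
      then have "?m > 0" "?g d > 0"
        by (simp_all only: nat_0_less_mult_iff)
      have "real (card (F d)) \<le> real_of_int (Z - 0) / real ?m + 1"
      proof (rule card_congruent_le)
        fix x y assume x: "x \<in> F d" and y: "y \<in> F d"
        have "int d dvd (x - z0) - (y - z0)"
          by (rule dvd_diff[OF codvd(2)[OF x] codvd(2)[OF y]])
        moreover have "int (n div d) dvd (x + z0) - (y + z0)"
          by (rule dvd_diff[OF codvd(1)[OF x] codvd(1)[OF y]])
        ultimately have "lcm (int d) (int (n div d)) dvd x - y"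
          by (intro lcm_least) (auto simp: algebra_simps)
        then show "int ?m dvd x - y"
          by (simp only: lcm_int_int_eq)
      qed (use assms \<open>?m > 0\<close> in \<open>auto simp: F_def\<close>)
      also have "real_of_int (Z - 0) / real ?m = real (?g d) * real_of_int Z / real n"
      proof -
        have "real n = real (?g d) * real ?m"
          using gm by (metis of_nat_mult)
        then show ?thesis
          using \<open>?m > 0\<close> \<open>?g d > 0\<close> by (simp add: field_simps)
      qed
      finally show "real (card (F d)) \<le> real (?g d) * real_of_int Z / real n + 1" .
    qed
    finally show ?thesis .
  qed
qed

subsection \<open>The divisor bound\<close>

lemma card_divisors_mult_le:
  fixes m n :: nat
  assumes "m > 0" "n > 0"
  shows "card {d. d dvd m * n} \<le> card {d. d dvd m} * card {d. d dvd n}"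
proof -
  have "{d. d dvd m * n} \<subseteq> (\<lambda>(x, y). x * y) ` ({d. d dvd m} \<times> {d. d dvd n})"
    by (blast dest: division_decomp)
  then have "card {d. d dvd m * n} \<le> card ({d. d dvd m} \<times> {d. d dvd n})"
    using assms by (intro surj_card_le) auto
  then show ?thesis
    by (simp add: card_cartesian_product)
qed

lemma card_divisors_prod_le:
  fixes f :: "'a \<Rightarrow> nat"
  assumes "finite A" "\<And>x. x \<in> A \<Longrightarrow> f x > 0"
  shows "card {d. d dvd prod f A} \<le> (\<Prod>x\<in>A. card {d. d dvd f x})"
  using assms
proof (induction A rule: finite_induct)
  case (insert x A)
  have "card {d. d dvd prod f (insert x A)} \<le> card {d. d dvd f x} * card {d. d dvd prod f A}"
    using insert by (simp add: card_divisors_mult_le prod_pos)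
  also have "\<dots> \<le> card {d. d dvd f x} * (\<Prod>x\<in>A. card {d. d dvd f x})"
    using insert by (intro mult_le_mono2) auto
  finally show ?case
    using insert by simp
qed auto

lemma card_divisors_prime_power:
  fixes p :: nat
  assumes "prime p"
  shows "card {d. d dvd p ^ k} = k + 1"
proof -
  have "{d. d dvd p ^ k} = (\<lambda>i. p ^ i) ` {..k}"
    using divides_primepow_nat[OF assms] by auto
  moreover have "inj_on (\<lambda>i. p ^ i) {..k}"
    using prime_gt_1_nat[OF assms] by (intro inj_onI) (simp add: power_inject_exp)
  ultimately show ?thesis
    by (simp add: card_image)
qed

text \<open>By submultiplicativity it suffices to compare \<open>k + 1\<close> with p^(k \<delta>)
  for each prime power. A constant factor \<open>B\<close> is lost only at the primes below
  \<open>P\<close>, so \<open>B ^ P\<close> serves for all \<open>n\<close>.\<close>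

lemma divisor_bound:
  fixes \<delta> :: real
  assumes "\<delta> > 0"
  obtains C where "C > 0" "\<And>n::nat. n > 0 \<Longrightarrow> real (card {d. d dvd n}) \<le> C * real n powr \<delta>"
proof -
  \<comment> \<open>\<open>B\<close> is chosen so that \<open>B \<ge> 1\<close> and
    \<open>B * \<delta> * ln 2 \<ge> 1\<close>, which gives
    \<open>k + 1 \<le> B * (1 + \<delta> * k * ln 2)\<close>. From \<open>P\<close> on, p^\<delta>
    is at least 2, and \<open>k + 1 \<le> 2 ^ k\<close> needs no constant.\<close>
  define B where "B = 1 + 1 / (\<delta> * ln 2)"
  define P where "P = nat \<lceil>2 powr (1 / \<delta>)\<rceil>"
  have B: "B \<ge> 1"
    using assms by (simp add: B_def)
  have large: "real (k + 1) \<le> real (p ^ k) powr \<delta>" if "prime p" "p \<ge> P" for p k :: nat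
  proof -
    have "2 powr (1 / \<delta>) \<le> real p"
      using that by (simp add: P_def)
    then have "(2 powr (1 / \<delta>)) powr \<delta> \<le> real p powr \<delta>"
      using assms by (intro powr_mono2) auto
    then have "2 \<le> real p powr \<delta>"
      using assms by (simp add: powr_powr)
    then have "(2::real) ^ k \<le> (real p powr \<delta>) ^ k"
      by (intro power_mono) auto
    also have "\<dots> = real (p ^ k) powr \<delta>"
      using prime_gt_0_nat[OF that(1)]
      by (simp add: powr_powr powr_realpow[symmetric] mult.commute)
    finally show ?thesis
      using of_nat_mono[OF Suc_leI[OF less_exp[of k]], where 'a = real] by simp
  qed
  have small: "real (k + 1) \<le> B * real (p ^ k) powr \<delta>" if "prime p" for p k :: nat
  proof -
    have p2: "real p \<ge> 2"
      using prime_ge_2_nat[OF that] by simp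
    have "1 + \<delta> * (real k * ln 2) \<le> exp (\<delta> * (real k * ln 2))"
      by (rule exp_ge_add_one_self)
    also have "\<dots> \<le> exp (\<delta> * (real k * ln (real p)))"
      using p2 assms by (auto intro!: mult_left_mono)
    also have "\<dots> = real (p ^ k) powr \<delta>"
      using p2 by (simp add: powr_def ln_realpow)
    finally have *: "1 + \<delta> * (real k * ln 2) \<le> real (p ^ k) powr \<delta>" .
    have "real (k + 1) \<le> B * (1 + \<delta> * (real k * ln 2))"
      using assms by (simp add: B_def field_simps)
    also have "\<dots> \<le> B * real (p ^ k) powr \<delta>"
      using * B by (intro mult_left_mono) auto
    finally show ?thesis .
  qed
  have "real (card {d. d dvd n}) \<le> B ^ P * real n powr \<delta>" if n: "n > 0" for n :: nat
  proof -
    let ?S = "prime_factors n"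
    let ?k = "\<lambda>p. multiplicity p n"
    have n_eq: "n = (\<Prod>p\<in>?S. p ^ ?k p)"
      using n prime_factorization_nat by blast
    have "card {d. d dvd (\<Prod>p\<in>?S. p ^ ?k p)} \<le> (\<Prod>p\<in>?S. card {d. d dvd p ^ ?k p})"
      by (rule card_divisors_prod_le) (auto simp: in_prime_factors_iff prime_gt_0_nat)
    then have "card {d. d dvd n} \<le> (\<Prod>p\<in>?S. card {d. d dvd p ^ ?k p})"
      by (simp only: n_eq[symmetric])
    also have "\<dots> = (\<Prod>p\<in>?S. ?k p + 1)"
      by (intro prod.cong) (auto simp: card_divisors_prime_power in_prime_factors_iff)
    finally have "real (card {d. d dvd n}) \<le> (\<Prod>p\<in>?S. real (?k p + 1))"
      by (metis (mono_tags, lifting) of_nat_le_iff of_nat_prod prod.cong)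
    also have "\<dots> \<le> (\<Prod>p\<in>?S. (if p < P then B else 1) * real (p ^ ?k p) powr \<delta>)"
    proof (rule prod_mono)
      fix p assume "p \<in> ?S"
      then have "prime p"
        by (simp add: in_prime_factors_iff)
      then show "0 \<le> real (?k p + 1) \<and>
          real (?k p + 1) \<le> (if p < P then B else 1) * real (p ^ ?k p) powr \<delta>"
        using small[of p "?k p"] large[of p "?k p"] by (cases "p < P") simp_all
    qed
    also have "\<dots> = (\<Prod>p\<in>?S. if p < P then B else 1) * (\<Prod>p\<in>?S. real (p ^ ?k p) powr \<delta>)"
      by (rule prod.distrib)
    also have "(\<Prod>p\<in>?S. real (p ^ ?k p) powr \<delta>) = real (\<Prod>p\<in>?S. p ^ ?k p) powr \<delta>"
      by (simp add: prod_powr_distrib)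
    also have "\<dots> = real n powr \<delta>"
      by (simp only: n_eq[symmetric])
    also have "(\<Prod>p\<in>?S. if p < P then B else 1) = B ^ card (?S \<inter> {p. p < P})"
      by (subst prod.If_cases) auto
    also have "\<dots> \<le> B ^ P"
    proof (rule power_increasing[OF _ B])
      have "card (?S \<inter> {p. p < P}) \<le> card {..<P}"
        by (intro card_mono) auto
      then show "card (?S \<inter> {p. p < P}) \<le> P"
        by simp
    qed
    finally show ?thesis
      by (simp add: mult_right_mono)
  qed
  then show ?thesis
    using that[of "B ^ P"] B by simp
qed

subsection \<open>Forms with a square value at a given point\<close>

text \<open>The factor \<open>g\<close> is the excess in the number of square roots; it is paid for
  by the rarity of such \<open>u\<close>. They are at most 8N/g^2 + 1 in number, which gives 8N/g +
  g after weighting. The second term is controlled only because \<open>u\<close> is nonzero, which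
  forces \<open>g \<le> 4 * N\<close>; hence 12 = 8 + 4.\<close>

lemma mult_card_common_square_divisor_le:
  fixes g a N :: nat and b v :: int
  assumes "g > 0" "g dvd a" and cop: "coprime (int a) b"
  shows "real g * real (card {u \<in> {- int N..int N} - {0}. int (g\<^sup>2) dvd 4 * (b ^ 3 * (u * b + v * int a))})
    \<le> 12 * real N"
proof -
  let ?S = "{u \<in> {- int N..int N} - {0}. int (g\<^sup>2) dvd 4 * (b ^ 3 * (u * b + v * int a))}"
  have copg: "coprime (int g) b"
    using cop assms(2) by (meson coprime_divisors dvd_refl int_dvd_int_iff)
  show ?thesis
  proof (cases "?S = {}")
    case True
    show ?thesis
      unfolding True by simp
  next
    case False
    then obtain u where u: "u \<in> ?S"
      by blast
    have gN: "g \<le> 4 * N"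
    proof -
      have "int g dvd int (g\<^sup>2)"
        by (simp add: power2_eq_square)
      also have "\<dots> dvd 4 * (b ^ 3 * (u * b + v * int a))"
        using u by simp
      \<comment> \<open>Modulo \<open>g\<close> the term with \<open>v\<close> disappears because
        \<open>g\<close> divides \<open>a\<close>, and \<open>b\<close> can be cancelled.\<close>
      finally have "int g dvd 4 * (b ^ 3 * (u * b + v * int a)) - int a * (4 * b ^ 3 * v)"
        using assms(2) by (intro dvd_diff[of _ "4 * (b ^ 3 * (u * b + v * int a))"]) simp_all
      also have "\<dots> = b ^ 4 * (4 * u)"
        by algebra
      finally have "int g dvd 4 * u"
        using copg by (simp add: coprime_dvd_mult_right_iff)
      then have "int g \<le> \<bar>4 * u\<bar>"
        using u by (intro zdvd_imp_le) auto
      then show ?thesis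
        using u by auto
    qed
    \<comment> \<open>The factor 4 need not be invertible modulo \<open>g\<^sup>2\<close>, so the
      class modulo \<open>g\<^sup>2\<close> is that of \<open>4 * u\<close>, in an interval of
      length 8N.\<close>
    have "card ?S = card ((*) 4 ` ?S)"
      by (intro card_image[symmetric]) (auto simp: inj_on_def)
    also have "real \<dots> \<le> real_of_int (4 * int N - (- 4 * int N)) / real (g\<^sup>2) + 1"
    proof (rule card_congruent_le)
      fix x y assume "x \<in> (*) 4 ` ?S" "y \<in> (*) 4 ` ?S"
      then obtain r s where r: "x = 4 * r" "r \<in> ?S" and s: "y = 4 * s" "s \<in> ?S"
        by blast
      have "int (g\<^sup>2) dvd 4 * (b ^ 3 * (r * b + v * int a)) - 4 * (b ^ 3 * (s * b + v * int a))"
        using r s by (intro dvd_diff[of _ "4 * (b ^ 3 * (r * b + v * int a))"]) simp_all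
      also have "\<dots> = b ^ 4 * (x - y)"
        unfolding r s by algebra
      finally show "int (g\<^sup>2) dvd x - y"
        using copg by (simp add: coprime_dvd_mult_right_iff)
    qed (use assms in auto)
    finally have "real g * real (card ?S) \<le> real g * (8 * real N / (real g)\<^sup>2 + 1)"
      by (intro mult_left_mono) auto
    also have "\<dots> = 8 * real N / real g + real g"
      using assms(1) by (simp add: field_simps power2_eq_square)
    also have "8 * real N / real g \<le> 8 * real N"
      using assms(1) by (simp add: divide_le_eq mult_le_cancel_left1)
    also have "real g \<le> 4 * real N"
      using of_nat_mono[OF gN, where 'a = real] by simp
    finally show ?thesis
      by simp
  qed
qed

lemma finite_Collect_int_interval: "finite {z \<in> {u..v::int}. P z}"
  by (rule finite_subset[of _ "{u..v}"]) auto

text \<open>For a single pair \<open>(v, u)\<close> the number of roots may be large, so the bound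
  is obtained by summing over \<open>u\<close> before summing over the divisors \<open>d\<close>:
  for each \<open>d\<close> the weight \<open>g d\<close> is then absorbed by the preceding average.
  The modulus being the square of \<open>a\<close> makes \<open>g d\<close> a divisor of
  \<open>a\<close>, as that average requires.\<close>

lemma card_residue_triples_le:
  fixes a N w :: nat and b :: int
  assumes "a > 0" and cop: "coprime (int a) b"
  shows "real (card (SIGMA (v, u) : {- int N..int N} \<times> ({- int N..int N} - {0}).
        {z \<in> {0..int (w * a\<^sup>2)}. int (a\<^sup>2) dvd z\<^sup>2 - b ^ 3 * (u * b + v * int a)}))
    \<le> real (card {d. d dvd a\<^sup>2}) * (2 * real N + 1) * (12 * real N) * (real w + 1)"
proof -
  let ?V = "{- int N..int N}"
  let ?U = "{- int N..int N} - {0}"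
  let ?c = "\<lambda>v u. b ^ 3 * (u * b + v * int a)"
  let ?D = "{d. d dvd a\<^sup>2}"
  define g where "g d = gcd d (a\<^sup>2 div d)" for d
  have finD: "finite ?D"
    using assms by simp
  have g: "g d > 0" "g d dvd a" if "d dvd a\<^sup>2" for d
  proof -
    show "g d > 0"
      using that assms by (auto simp: g_def intro!: Nat.gr0I)
    have "(g d)\<^sup>2 dvd a\<^sup>2"
      unfolding g_def by (rule gcd_codivisor_square_dvd[OF that])
    then show "g d dvd a"
      by simp
  qed
  have roots: "real (card {z \<in> {0..int (w * a\<^sup>2)}. int (a\<^sup>2) dvd z\<^sup>2 - ?c v u})
      \<le> (\<Sum>d\<in>?D. if int ((g d)\<^sup>2) dvd 4 * ?c v u then real (g d) * (real w + 1) else 0)" for v u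
  proof -
    have "real (card {z \<in> {0..int (w * a\<^sup>2)}. int (a\<^sup>2) dvd z\<^sup>2 - ?c v u})
        \<le> (\<Sum>d | d dvd a\<^sup>2 \<and> int ((g d)\<^sup>2) dvd 4 * ?c v u.
            real (g d) * real_of_int (int (w * a\<^sup>2)) / real (a\<^sup>2) + 1)"
      unfolding g_def using assms by (intro card_square_roots_mod_le) auto
    also have "\<dots> \<le> (\<Sum>d | d dvd a\<^sup>2 \<and> int ((g d)\<^sup>2) dvd 4 * ?c v u. real (g d) * (real w + 1))"
    proof (rule sum_mono)
      fix d assume "d \<in> {d. d dvd a\<^sup>2 \<and> int ((g d)\<^sup>2) dvd 4 * ?c v u}"
      then have "g d > 0"
        using g by blast
      \<comment> \<open>The left side is \<open>g d * w + 1\<close>, so \<open>g d \<ge> 1\<close>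
        is all that is used.\<close>
      then show "real (g d) * real_of_int (int (w * a\<^sup>2)) / real (a\<^sup>2) + 1 \<le> real (g d) * (real w + 1)"
        using assms(1) by (simp add: algebra_simps)
    qed
    also have "\<dots> = (\<Sum>d\<in>?D. if int ((g d)\<^sup>2) dvd 4 * ?c v u then real (g d) * (real w + 1) else 0)"
      by (simp only: sum.inter_filter[OF finD, symmetric] mem_Collect_eq)
    finally show ?thesis .
  qed
  have "real (card (SIGMA (v, u) : ?V \<times> ?U. {z \<in> {0..int (w * a\<^sup>2)}. int (a\<^sup>2) dvd z\<^sup>2 - ?c v u}))
      = (\<Sum>(v, u) \<in> ?V \<times> ?U. real (card {z \<in> {0..int (w * a\<^sup>2)}. int (a\<^sup>2) dvd z\<^sup>2 - ?c v u}))"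
    unfolding case_prod_unfold
    by (subst card_SigmaI) (simp_all only: finite_Collect_int_interval of_nat_sum
      finite_cartesian_product finite_Diff finite_atLeastAtMost_int simp_thms ball_triv)
  also have "\<dots> \<le> (\<Sum>(v, u) \<in> ?V \<times> ?U.
      \<Sum>d\<in>?D. if int ((g d)\<^sup>2) dvd 4 * ?c v u then real (g d) * (real w + 1) else 0)"
    by (intro sum_mono) (auto simp only: case_prod_unfold intro: roots)
  also have "\<dots> = (\<Sum>v\<in>?V. \<Sum>d\<in>?D.
      \<Sum>u\<in>?U. if int ((g d)\<^sup>2) dvd 4 * ?c v u then real (g d) * (real w + 1) else 0)"
    by (subst sum.cartesian_product[symmetric], subst (2) sum.swap) (rule refl)
  also have "\<dots> \<le> (\<Sum>v\<in>?V. \<Sum>d\<in>?D. 12 * real N * (real w + 1))"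
  proof (intro sum_mono)
    fix v d assume "d \<in> ?D"
    then have gd: "g d > 0" "g d dvd a"
      using g by auto
    have "(\<Sum>u\<in>?U. if int ((g d)\<^sup>2) dvd 4 * ?c v u then real (g d) * (real w + 1) else 0)
        = (\<Sum>u | u \<in> ?U \<and> int ((g d)\<^sup>2) dvd 4 * ?c v u. real (g d) * (real w + 1))"
      by (rule sum.inter_filter[symmetric]) auto
    also have "\<dots> = real (g d) * real (card {u \<in> ?U. int ((g d)\<^sup>2) dvd 4 * ?c v u}) * (real w + 1)"
      by simp
    also have "\<dots> \<le> 12 * real N * (real w + 1)"
      by (intro mult_right_mono mult_card_common_square_divisor_le gd cop) auto
    finally show "(\<Sum>u\<in>?U. if int ((g d)\<^sup>2) dvd 4 * ?c v u then real (g d) * (real w + 1) else 0)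
        \<le> 12 * real N * (real w + 1)" .
  qed
  also have "\<dots> = real (card ?D) * (2 * real N + 1) * (12 * real N) * (real w + 1)"
    by (simp add: nat_add_distrib)
  finally show ?thesis .
qed

section \<open>Fibre counting at a fixed coprime point\<close>

lemma card_le_mult_card_image:
  assumes "finite S" "\<And>t. t \<in> f ` S \<Longrightarrow> real (card {s \<in> S. f s = t}) \<le> K"
  shows "real (card S) \<le> K * real (card (f ` S))"
proof -
  have "S = (\<Union>t\<in>f ` S. {s \<in> S. f s = t})"
    by auto
  then have "card S \<le> (\<Sum>t\<in>f ` S. card {s \<in> S. f s = t})"
    using card_UN_le[of "f ` S" "\<lambda>t. {s \<in> S. f s = t}"] assms(1) by simp
  then have "real (card S) \<le> (\<Sum>t\<in>f ` S. real (card {s \<in> S. f s = t}))"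
    by (simp only: of_nat_sum[symmetric] of_nat_le_iff)
  also have "\<dots> \<le> (\<Sum>t\<in>f ` S. K)"
    by (intro sum_mono assms(2))
  finally show ?thesis
    by (simp add: mult.commute)
qed

text \<open>Forms of discriminant zero are included: for upper bounds they do no harm, and the box
  becomes a product of intervals.\<close>

definition height_box :: "nat \<Rightarrow> int_quartic set" where
  "height_box N = {f. quartic_height f \<le> int N}"

lemma mem_height_box_iff:
  "f \<in> height_box N \<longleftrightarrow> coeff0 f \<in> {- int N..int N} \<and> coeff1 f \<in> {- int N..int N} \<and>
     coeff2 f \<in> {- int N..int N} \<and> coeff3 f \<in> {- int N..int N} \<and> coeff4 f \<in> {- int N..int N}"
  by (auto simp: height_box_def quartic_height_def abs_le_iff)

lemma height_box_eq_image:
  "height_box N = (\<lambda>(a, b, c, d, e). Quartic a b c d e) `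
     ({- int N..int N} \<times> {- int N..int N} \<times> {- int N..int N} \<times> {- int N..int N} \<times> {- int N..int N})"
  (is "_ = ?q ` ?B")
proof
  show "height_box N \<subseteq> ?q ` ?B"
  proof
    fix f assume "f \<in> height_box N"
    then show "f \<in> ?q ` ?B"
      by (cases f) (auto simp: mem_height_box_iff image_iff)
  qed
qed (auto simp: mem_height_box_iff)

lemma finite_height_box: "finite (height_box N)"
  unfolding height_box_eq_image by auto

definition square_at :: "int_quartic \<Rightarrow> int \<Rightarrow> int \<Rightarrow> bool" where
  "square_at f x y \<longleftrightarrow> (\<exists>z. z\<^sup>2 = quartic_eval f x y)"

lemma quartic_eval_le:
  fixes a N :: nat and b :: int
  assumes "f \<in> height_box N" "\<bar>b\<bar> \<le> int a"
  shows "\<bar>quartic_eval f (int a) b\<bar> \<le> 5 * int N * int a ^ 4"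
proof -
  have *: "\<bar>c * int a ^ i * b ^ j\<bar> \<le> int N * int a ^ 4"
    if "\<bar>c\<bar> \<le> int N" "i + j = 4" for c i j
  proof -
    have "\<bar>c * int a ^ i * b ^ j\<bar> = \<bar>c\<bar> * int a ^ i * \<bar>b\<bar> ^ j"
      by (simp add: abs_mult power_abs)
    also have "\<dots> \<le> int N * int a ^ i * int a ^ j"
      using that assms(2) by (intro mult_mono power_mono) auto
    also have "\<dots> = int N * int a ^ 4"
      using that by (simp add: mult.assoc flip: power_add)
    finally show ?thesis .
  qed
  have "\<bar>coeff0 f\<bar> \<le> int N" "\<bar>coeff1 f\<bar> \<le> int N" "\<bar>coeff2 f\<bar> \<le> int N" "\<bar>coeff3 f\<bar> \<le> int N"
    "\<bar>coeff4 f\<bar> \<le> int N"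
    using assms(1) by (auto simp: mem_height_box_iff)
  note * = *[OF this(1), of 4 0] *[OF this(2), of 3 1] *[OF this(3), of 2 2] *[OF this(4), of 1 3]
    *[OF this(5), of 0 4]
  show ?thesis
    using * unfolding quartic_eval_def by simp
qed

text \<open>
  Given \<open>coeff3\<close>, \<open>coeff4\<close> and the root \<open>z\<close>, the coefficients \<open>coeff2\<close> and then \<open>coeff1\<close> are each
  determined modulo \<open>a\<close>, and finally \<open>coeff0\<close> is determined.
\<close>

lemma card_square_at_le:
  fixes a N w :: nat and b :: int
  assumes a: "a > 0" and cop: "coprime (int a) b" and ba: "\<bar>b\<bar> \<le> int a" and w: "5 * N \<le> w\<^sup>2"
  shows "real (card {f \<in> height_box N. coeff4 f \<noteq> 0 \<and> square_at f (int a) b})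
    \<le> (2 * real N / real a + 1)\<^sup>2 *
      (real (card {d. d dvd a\<^sup>2}) * (2 * real N + 1) * (12 * real N) * (real w + 1))"
proof -
  let ?F = "{f \<in> height_box N. coeff4 f \<noteq> 0 \<and> square_at f (int a) b}"
  let ?K = "2 * real N / real a + 1"
  define T where "T = (SIGMA (v, u) : {- int N..int N} \<times> ({- int N..int N} - {0}).
        {z \<in> {0..int (w * a\<^sup>2)}. int (a\<^sup>2) dvd z\<^sup>2 - b ^ 3 * (u * b + v * int a)})"
  have finT: "finite T"
    unfolding T_def case_prod_unfold
    by (intro finite_SigmaI finite_Collect_int_interval finite_cartesian_product) simp_all
  define root where "root f = (SOME z. z \<ge> 0 \<and> z\<^sup>2 = quartic_eval f (int a) b)" for f
  have root: "root f \<ge> 0" "(root f)\<^sup>2 = quartic_eval f (int a) b" if "f \<in> ?F" for f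
  proof -
    from that obtain z where "z\<^sup>2 = quartic_eval f (int a) b"
      by (auto simp: square_at_def)
    then have "\<bar>z\<bar> \<ge> 0 \<and> \<bar>z\<bar>\<^sup>2 = quartic_eval f (int a) b"
      by simp
    then have "root f \<ge> 0 \<and> (root f)\<^sup>2 = quartic_eval f (int a) b"
      unfolding root_def by (rule someI)
    then show "root f \<ge> 0" "(root f)\<^sup>2 = quartic_eval f (int a) b"
      by auto
  qed
  \<comment> \<open>The image lies in the set of triples already counted. A fibre has at most
    \<open>?K\<close> values of \<open>coeff2\<close> and, for each of them, at most
    \<open>?K\<close> values of \<open>coeff1\<close>.\<close>
  define \<pi> where "\<pi> f = ((coeff3 f, coeff4 f), root f)" for f
  have cong: "int a dvd x - y" if "int a ^ (k + 1) dvd int a ^ k * b ^ j * (x - y)" for x y k j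
  proof -
    have "int a dvd b ^ j * (x - y)"
      using that a by (simp add: mult.assoc)
    then show ?thesis
      using cop by (simp add: coprime_dvd_mult_right_iff)
  qed
  have finF: "finite ?F"
    using finite_height_box by simp
  have "\<pi> ` ?F \<subseteq> T"
  proof
    fix t assume "t \<in> \<pi> ` ?F"
    then obtain f where f: "f \<in> ?F" "t = \<pi> f"
      by blast
    \<comment> \<open>\<open>w\<close> is an integer bound for the square root of
      \<open>5 * N\<close>, where 5 is the number of monomials.\<close>
    have "(root f)\<^sup>2 \<le> int (5 * N) * int a ^ 4"
      using quartic_eval_le[OF _ ba, of f N] root[OF f(1)] f(1) by simp
    also have "\<dots> \<le> int (w\<^sup>2) * int a ^ 4"
      using w by (intro mult_right_mono) (simp_all only: of_nat_le_iff zero_le_power of_nat_0_le_iff)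
    also have "\<dots> = (int (w * a\<^sup>2))\<^sup>2"
      by (simp add: power_mult_distrib)
    finally have "root f \<le> int (w * a\<^sup>2)"
      by (rule power2_le_imp_le) simp
    \<comment> \<open>Only the monomials of \<open>coeff3\<close> and \<open>coeff4\<close> are not
      multiples of \<open>a\<^sup>2\<close>.\<close>
    moreover have "(root f)\<^sup>2 - b ^ 3 * (coeff4 f * b + coeff3 f * int a) =
        int (a\<^sup>2) * (coeff0 f * int a ^ 2 + coeff1 f * int a * b + coeff2 f * b\<^sup>2)"
      unfolding root(2)[OF f(1)] quartic_eval_def of_int_eq_id id_apply of_nat_power by algebra
    ultimately show "t \<in> T"
      using f root[OF f(1)] by (auto simp: T_def \<pi>_def mem_height_box_iff)
  qed
  then have cardT: "real (card (\<pi> ` ?F)) \<le> real (card T)"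
    using card_mono[OF finT] by simp
  have "real (card ?F) \<le> (?K * ?K) * real (card (\<pi> ` ?F))"
  proof (rule card_le_mult_card_image[OF finF])
    fix t
    let ?G = "{f \<in> ?F. \<pi> f = t}"
    \<comment> \<open>Equal roots mean equal values at the point, and the last two monomials
      cancel.\<close>
    have eq: "int a ^ 4 * (coeff0 f - coeff0 f') + int a ^ 3 * b * (coeff1 f - coeff1 f')
        + int a ^ 2 * b ^ 2 * (coeff2 f - coeff2 f') = 0" if "f \<in> ?G" "f' \<in> ?G" for f f'
    proof -
      have "quartic_eval f (int a) b = quartic_eval f' (int a) b" "coeff3 f = coeff3 f'"
        "coeff4 f = coeff4 f'"
        using that root[of f] root[of f'] by (auto simp: \<pi>_def)
      then show ?thesis
        unfolding quartic_eval_def of_int_eq_id id_apply by algebra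
    qed
    have "real (card ?G) \<le> ?K * real (card (coeff2 ` ?G))"
    proof (rule card_le_mult_card_image)
      fix s
      let ?H = "{f \<in> ?G. coeff2 f = s}"
      have eqH: "int a ^ 4 * (coeff0 f - coeff0 f') + int a ^ 3 * b * (coeff1 f - coeff1 f') = 0"
        if "f \<in> ?H" "f' \<in> ?H" for f f'
        using eq[of f f'] that by simp
      have "inj_on coeff1 ?H"
      proof
        fix f f' assume ff': "f \<in> ?H" "f' \<in> ?H" "coeff1 f = coeff1 f'"
        then have "coeff0 f = coeff0 f'"
          using eqH[OF ff'(1,2)] a by simp
        with ff' show "f = f'"
          by (intro int_quartic.expand) (auto simp: \<pi>_def)
      qed
      then have "real (card ?H) = real (card (coeff1 ` ?H))"
        by (simp add: card_image)
      also have "\<dots> \<le> real_of_int (int N - (- int N)) / real a + 1"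
      proof (rule card_congruent_le[OF a])
        fix x y assume "x \<in> coeff1 ` ?H" "y \<in> coeff1 ` ?H"
        then obtain f f' where f: "f \<in> ?H" "x = coeff1 f" and f': "f' \<in> ?H" "y = coeff1 f'"
          by blast
        have "int a ^ 3 * b ^ 1 * (x - y) = int a ^ 4 * (coeff0 f' - coeff0 f)"
          using eqH[OF f(1) f'(1)] f f' by algebra
        then show "int a dvd x - y"
          by (intro cong[of 3 1]) simp
      qed (auto simp: mem_height_box_iff)
      finally show "real (card ?H) \<le> ?K"
        by simp
    qed (rule finite_subset[OF _ finF], blast)
    also have "real (card (coeff2 ` ?G)) \<le> real_of_int (int N - (- int N)) / real a + 1"
    proof (rule card_congruent_le[OF a])
      fix x y assume "x \<in> coeff2 ` ?G" "y \<in> coeff2 ` ?G"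
      then obtain f f' where f: "f \<in> ?G" "x = coeff2 f" and f': "f' \<in> ?G" "y = coeff2 f'"
        by blast
      have "int a ^ 2 * b ^ 2 * (x - y)
          = int a ^ 3 * (int a * (coeff0 f' - coeff0 f) + b * (coeff1 f' - coeff1 f))"
        using eq[OF f(1) f'(1)] f f' by algebra
      then show "int a dvd x - y"
        by (intro cong[of 2 2]) simp
    qed (auto simp: mem_height_box_iff)
    finally show "real (card ?G) \<le> ?K * ?K"
      by (simp add: mult_left_mono)
  qed
  also have "\<dots> \<le> (?K * ?K) * real (card T)"
    using cardT by (intro mult_left_mono) auto
  also have "\<dots> \<le> (?K * ?K) *
      (real (card {d. d dvd a\<^sup>2}) * (2 * real N + 1) * (12 * real N) * (real w + 1))"
    unfolding T_def using card_residue_triples_le[OF a cop] by (intro mult_left_mono) auto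
  finally show ?thesis
    by (simp only: power2_eq_square)
qed

subsection \<open>Counting the exceptional forms\<close>

definition reverse_form :: "int_quartic \<Rightarrow> int_quartic" where
  "reverse_form f = Quartic (coeff4 f) (coeff3 f) (coeff2 f) (coeff1 f) (coeff0 f)"

lemma coeff_reverse_form [simp]:
  "coeff0 (reverse_form f) = coeff4 f" "coeff1 (reverse_form f) = coeff3 f"
  "coeff2 (reverse_form f) = coeff2 f" "coeff3 (reverse_form f) = coeff1 f"
  "coeff4 (reverse_form f) = coeff0 f"
  by (simp_all add: reverse_form_def)

lemma reverse_form_reverse_form [simp]: "reverse_form (reverse_form f) = f"
  by (simp add: reverse_form_def)

lemma reverse_form_in_height_box_iff [simp]: "reverse_form f \<in> height_box N \<longleftrightarrow> f \<in> height_box N"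
  by (auto simp: mem_height_box_iff)

lemma square_at_reverse_form [simp]: "square_at (reverse_form f) x y \<longleftrightarrow> square_at f y x"
  by (simp add: square_at_def quartic_eval_def algebra_simps)

lemma square_at_minus: "square_at f (- x) (- y) \<longleftrightarrow> square_at f x y"
  by (simp add: square_at_def quartic_eval_def)

section \<open>From rational points to coprime integer points\<close>

lemma rat_power2_eq_of_int:
  fixes r :: rat
  assumes "r\<^sup>2 = of_int k"
  obtains m where "r = of_int m"
proof -
  obtain p q where pq: "quotient_of r = (p, q)"
    by fastforce
  then have "q > 0" and cop: "coprime p q" and r: "r = of_int p / of_int q"
    by (auto dest: quotient_of_denom_pos quotient_of_coprime quotient_of_div)
  have "(of_int (p\<^sup>2) :: rat) = of_int (k * q\<^sup>2)"
    using assms \<open>q > 0\<close> unfolding r by (simp add: field_simps)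
  then have "p\<^sup>2 = k * q\<^sup>2"
    by (simp only: of_int_eq_iff)
  then have "q\<^sup>2 dvd p\<^sup>2"
    by simp
  then have "q dvd p"
    by simp
  with cop \<open>q > 0\<close> have "q = 1"
    using coprime_common_divisor[of p q q] by simp
  then show ?thesis
    using that r by simp
qed

text \<open>Scaling with weights 1, 1, 2 makes the first two coordinates coprime integers. The
  scaled third coordinate is a rational number with integral square, hence an integer. The Weil
  height is unchanged by the scaling and has a closed form for coprime integers.\<close>

lemma rational_point_coprime_coordinates:
  assumes "(x, y, z) \<in> rational_points f"
  obtains a b :: int where "coprime a b" "square_at f a b"
    "weil_height x y = ln (real_of_int (max \<bar>a\<bar> \<bar>b\<bar>))"
proof -
  obtain p q where pq: "x = of_int p / of_int q" "q \<noteq> 0"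
    by (metis rat_fraction_cases)
  obtain r s where rs: "y = of_int r / of_int s" "s \<noteq> 0"
    by (metis rat_fraction_cases)
  have "p * s \<noteq> 0 \<or> r * q \<noteq> 0"
    using rational_points_xy_nonzero[OF assms] pq rs by auto
  then have "gcd (p * s) (r * q) \<noteq> 0"
    by auto
  then obtain g a b where g: "g \<noteq> 0" and ab: "p * s = a * g" "r * q = b * g" "coprime a b"
    using gcd_coprime_exists by blast
  define t :: rat where "t = of_int (q * s) / of_int g"
  have t: "t \<noteq> 0"
    using g pq rs by (simp add: t_def)
  have "t * x = of_int (p * s) / of_int g" "t * y = of_int (r * q) / of_int g"
    using g pq rs by (simp_all add: t_def)
  then have tx: "t * x = of_int a" and ty: "t * y = of_int b"
    using g by (simp_all add: ab(1,2) del: of_int_mult) simp_all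
  have "(t\<^sup>2 * z)\<^sup>2 = quartic_eval f (of_int a) (of_int b)"
    using rational_points_scale[OF assms t] by (simp add: rational_points_def tx ty)
  also have "\<dots> = of_int (quartic_eval f a b)"
    by (simp add: quartic_eval_def)
  finally have eq: "(t\<^sup>2 * z)\<^sup>2 = of_int (quartic_eval f a b)" .
  then obtain m where "t\<^sup>2 * z = of_int m"
    by (rule rat_power2_eq_of_int)
  with eq have "of_int (m\<^sup>2) = (of_int (quartic_eval f a b) :: rat)"
    by simp
  then have "square_at f a b"
    unfolding square_at_def by (metis of_int_eq_iff)
  moreover have "weil_height x y = ln (real_of_int (max \<bar>a\<bar> \<bar>b\<bar>))"
    using weil_height_scale[OF rational_points_xy_nonzero[OF assms] t] weil_height_coprime[OF ab(3)]
    by (simp add: tx ty)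
  ultimately show ?thesis
    using that ab(3) by blast
qed

lemma quartic_height_pos:
  assumes "discriminant f \<noteq> 0"
  shows "quartic_height f \<ge> 1"
proof (rule ccontr)
  assume "\<not> ?thesis"
  then have "quartic_height f \<le> int 0"
    by simp
  then have "f \<in> height_box 0"
    by (simp add: height_box_def)
  then show False
    using assms by (simp add: mem_height_box_iff discriminant_def quartic_discr_def)
qed

text \<open>One half of the exceptional set, for points whose first coordinate is positive and
  dominant. The other half is its image under \<open>reverse_form\<close>, where the condition on
  \<open>coeff4\<close> becomes one on \<open>coeff0\<close>.\<close>

definition square_forms :: "nat \<Rightarrow> nat \<Rightarrow> int_quartic set" where
  "square_forms N M = {f \<in> height_box N. coeff4 f \<noteq> 0 \<and>
     (\<exists>a\<in>{1..M}. \<exists>b\<in>{- int a..int a}. coprime (int a) b \<and> square_at f (int a) b)}"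

lemma small_point_imp_square_forms:
  assumes f: "f \<in> forms_below X" and P: "(x, y, z) \<in> rational_points f"
    and small: "weil_height x y < \<theta> * ln (real_of_int (quartic_height f))" and "\<theta> \<ge> 0"
  shows "f \<in> {f \<in> height_box (nat \<lfloor>X\<rfloor>). coeff0 f = 0 \<or> coeff4 f = 0}
    \<union> (square_forms (nat \<lfloor>X\<rfloor>) (nat \<lfloor>X powr \<theta>\<rfloor>)
        \<union> reverse_form ` square_forms (nat \<lfloor>X\<rfloor>) (nat \<lfloor>X powr \<theta>\<rfloor>))"
proof -
  let ?N = "nat \<lfloor>X\<rfloor>" and ?M = "nat \<lfloor>X powr \<theta>\<rfloor>" and ?H = "quartic_height f"
  have H: "?H \<ge> 1" and HX: "real_of_int ?H < X"
    using f quartic_height_pos by (auto simp: forms_below_def)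
  have fbox: "f \<in> height_box ?N"
    using H HX by (auto simp: height_box_def le_floor_iff)
  obtain a b where ab: "coprime a b" "square_at f a b"
    "weil_height x y = ln (real_of_int (max \<bar>a\<bar> \<bar>b\<bar>))"
    using P by (rule rational_point_coprime_coordinates)
  have mpos: "max \<bar>a\<bar> \<bar>b\<bar> \<ge> 1"
    using ab(1) by (cases "a = 0") auto
  have "ln (real_of_int (max \<bar>a\<bar> \<bar>b\<bar>)) < ln (real_of_int ?H powr \<theta>)"
    using small ab(3) H by (simp add: ln_powr)
  then have "real_of_int (max \<bar>a\<bar> \<bar>b\<bar>) < real_of_int ?H powr \<theta>"
    using mpos H by (subst (asm) ln_less_cancel_iff) auto
  also have "\<dots> \<le> X powr \<theta>"
    using H HX \<open>\<theta> \<ge> 0\<close> by (intro powr_mono2) auto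
  finally have M: "max \<bar>a\<bar> \<bar>b\<bar> \<le> int ?M"
    by (simp add: le_floor_iff)
  have *: "g \<in> square_forms ?N ?M"
    if g: "g \<in> height_box ?N" "coeff4 g \<noteq> 0" "coprime c d" "square_at g c d"
      "\<bar>d\<bar> \<le> \<bar>c\<bar>" "1 \<le> \<bar>c\<bar>" "\<bar>c\<bar> \<le> int ?M" for g c d
  proof -
    \<comment> \<open>Both coordinates are multiplied by the sign of \<open>c\<close>; a form of
      even degree keeps its value.\<close>
    define d' where "d' = sgn c * d"
    have c: "int (nat \<bar>c\<bar>) = sgn c * c"
      by (auto simp: sgn_if abs_if)
    have "sgn c = 1 \<or> sgn c = - 1"
      using g(6) by (auto simp: sgn_if)
    then have "square_at g (int (nat \<bar>c\<bar>)) d'" "coprime (int (nat \<bar>c\<bar>)) d'"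
      unfolding c d'_def using g(3,4) square_at_minus[of g c d] by auto
    moreover have "\<bar>d'\<bar> \<le> int (nat \<bar>c\<bar>)"
      using g(5,6) by (auto simp: d'_def abs_mult abs_sgn_eq)
    then have "d' \<in> {- int (nat \<bar>c\<bar>)..int (nat \<bar>c\<bar>)}"
      by (auto simp: abs_le_iff)
    moreover have "nat \<bar>c\<bar> \<in> {1..?M}"
      using g(6,7) by auto
    ultimately show ?thesis
      using g(1,2) unfolding square_forms_def by blast
  qed
  consider "coeff0 f = 0 \<or> coeff4 f = 0" | "coeff4 f \<noteq> 0" "\<bar>b\<bar> \<le> \<bar>a\<bar>"
    | "coeff0 f \<noteq> 0" "\<bar>a\<bar> \<le> \<bar>b\<bar>"
    by linarith
  then show ?thesis
  proof cases
    case 1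
    then show ?thesis
      using fbox by blast
  next
    case 2
    then show ?thesis
      using *[of f a b] fbox ab mpos M by auto
  next
    case 3
    then have "reverse_form f \<in> square_forms ?N ?M"
      using *[of "reverse_form f" b a] fbox ab mpos M by (auto simp: coprime_commute)
    then have "reverse_form (reverse_form f) \<in> reverse_form ` square_forms ?N ?M"
      by (rule imageI)
    then show ?thesis
      by simp
  qed
qed

section \<open>Summation over points and exponent count\<close>

lemma finite_square_forms: "finite (square_forms N M)"
  unfolding square_forms_def using finite_height_box by simp

lemma card_square_forms_le:
  fixes D :: real
  assumes w: "5 * N \<le> w\<^sup>2" and M: "M > 0"
    and D: "\<And>a. a > 0 \<Longrightarrow> a \<le> M \<Longrightarrow> real (card {d. d dvd a\<^sup>2}) \<le> D"
  shows "real (card (square_forms N M)) \<le> D * (2 * real N + 1) * (12 * real N) * (real w + 1)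
    * (24 * (real N)\<^sup>2 * (ln (real M) + 1) + 6 * (real M)\<^sup>2)"
proof -
  let ?F = "\<lambda>a b. {f \<in> height_box N. coeff4 f \<noteq> 0 \<and> square_at f (int a) b}"
  let ?B = "\<lambda>a. {b \<in> {- int a..int a}. coprime (int a) b}"
  define E where "E = D * (2 * real N + 1) * (12 * real N) * (real w + 1)"
  have "D \<ge> 0"
    using D[of 1] M by simp
  then have "E \<ge> 0"
    by (simp add: E_def)
  have "square_forms N M = (\<Union>a\<in>{1..M}. \<Union>b\<in>?B a. ?F a b)"
    unfolding square_forms_def by blast
  then have "card (square_forms N M) \<le> (\<Sum>a\<in>{1..M}. card (\<Union>b\<in>?B a. ?F a b))"
    using card_UN_le[of "{1..M}" "\<lambda>a. \<Union>b\<in>?B a. ?F a b"] by simp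
  also have "\<dots> \<le> (\<Sum>a\<in>{1..M}. \<Sum>b\<in>?B a. card (?F a b))"
    by (intro sum_mono card_UN_le finite_Collect_int_interval)
  finally have "real (card (square_forms N M)) \<le> (\<Sum>a\<in>{1..M}. \<Sum>b\<in>?B a. real (card (?F a b)))"
    by (simp only: of_nat_sum[symmetric] of_nat_le_iff)
  also have "\<dots> \<le> (\<Sum>a\<in>{1..M}. E * (24 * (real N)\<^sup>2 * inverse (real a) + 6 * real a))"
  proof (rule sum_mono)
    fix a assume a: "a \<in> {1..M}"
    let ?K = "2 * real N / real a + 1"
    have "(\<Sum>b\<in>?B a. real (card (?F a b))) \<le> (\<Sum>b\<in>?B a. ?K\<^sup>2 * E)"
    proof (rule sum_mono)
      fix b assume b: "b \<in> ?B a"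
      have "real (card (?F a b)) \<le> ?K\<^sup>2 *
          (real (card {d. d dvd a\<^sup>2}) * (2 * real N + 1) * (12 * real N) * (real w + 1))"
        using a b w by (intro card_square_at_le) (auto simp: abs_le_iff)
      also have "\<dots> \<le> ?K\<^sup>2 * E"
        unfolding E_def using D[of a] a by (intro mult_left_mono mult_right_mono) auto
      finally show "real (card (?F a b)) \<le> ?K\<^sup>2 * E" .
    qed
    also have "\<dots> = real (card (?B a)) * (?K\<^sup>2 * E)"
      by simp
    also have "\<dots> \<le> (3 * real a) * (?K\<^sup>2 * E)"
    proof (rule mult_right_mono)
      have "card (?B a) \<le> card {- int a..int a}"
        by (rule card_mono) auto
      also have "\<dots> \<le> 3 * a"
        using a by (simp add: nat_le_iff)
      finally show "real (card (?B a)) \<le> 3 * real a"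
        by linarith
    qed (use \<open>E \<ge> 0\<close> in simp)
    \<comment> \<open>Separating the square decouples the two ranges of \<open>a\<close>: the first
      term leads to a harmonic sum, the second to a sum of \<open>a\<close>. The 3 bounds
      \<open>2 * a + 1\<close> choices of \<open>b\<close>, whence 24 and 6.\<close>
    also have "\<dots> \<le> (3 * real a) * ((8 * (real N)\<^sup>2 / (real a)\<^sup>2 + 2) * E)"
    proof (intro mult_left_mono mult_right_mono \<open>E \<ge> 0\<close>)
      have "(u + 1)\<^sup>2 \<le> 2 * u\<^sup>2 + 2" for u :: real
        using zero_le_power2[of "u - 1"] by (simp add: power2_eq_square algebra_simps)
      then have "?K\<^sup>2 \<le> 2 * (2 * real N / real a)\<^sup>2 + 2" .
      then show "?K\<^sup>2 \<le> 8 * (real N)\<^sup>2 / (real a)\<^sup>2 + 2"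
        by (simp add: power_divide power_mult_distrib)
    qed simp
    also have "\<dots> = E * (24 * (real N)\<^sup>2 * inverse (real a) + 6 * real a)"
      using a by (simp add: field_simps power2_eq_square)
    finally show "(\<Sum>b\<in>?B a. real (card (?F a b)))
        \<le> E * (24 * (real N)\<^sup>2 * inverse (real a) + 6 * real a)" .
  qed
  also have "\<dots> = E * (24 * (real N)\<^sup>2 * harm M + 6 * (\<Sum>a\<in>{1..M}. real a))"
    by (simp add: harm_def sum.distrib flip: sum_distrib_left)
  also have "\<dots> \<le> E * (24 * (real N)\<^sup>2 * (ln (real M) + 1) + 6 * (real M)\<^sup>2)"
  proof (intro mult_left_mono add_mono \<open>E \<ge> 0\<close>)
    show "harm M \<le> ln (real M) + 1"
      \<comment> \<open>The sequence \<open>harm n - ln n\<close> decreases from its value 1 at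
        \<open>n = 1\<close>.\<close>
      using euler_mascheroni_sequence_decreasing[of 1 M] M by (simp add: harm_def)
    have "(\<Sum>a\<in>{1..M}. real a) \<le> (\<Sum>a\<in>{1..M}. real M)"
      by (intro sum_mono) auto
    then show "(\<Sum>a\<in>{1..M}. real a) \<le> (real M)\<^sup>2"
      by (simp add: power2_eq_square)
  qed auto
  finally show ?thesis
    unfolding E_def .
qed

lemma card_degenerate_forms_le:
  "real (card {f \<in> height_box N. coeff0 f = 0 \<or> coeff4 f = 0}) \<le> 2 * (2 * real N + 1) ^ 4"
proof -
  let ?I = "{- int N..int N}"
  let ?B = "?I \<times> ?I \<times> ?I \<times> ?I"
  have cardB: "card ?B = (2 * N + 1) ^ 4"
    by (simp add: card_cartesian_product power4_eq_xxxx nat_add_distrib nat_mult_distrib mult.assoc)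
  have "{f \<in> height_box N. coeff0 f = 0 \<or> coeff4 f = 0}
      \<subseteq> (\<lambda>(b, c, d, e). Quartic 0 b c d e) ` ?B \<union> (\<lambda>(a, b, c, d). Quartic a b c d 0) ` ?B"
  proof
    fix f assume "f \<in> {f \<in> height_box N. coeff0 f = 0 \<or> coeff4 f = 0}"
    then show "f \<in> (\<lambda>(b, c, d, e). Quartic 0 b c d e) ` ?B \<union> (\<lambda>(a, b, c, d). Quartic a b c d 0) ` ?B"
      by (cases f) (auto simp: mem_height_box_iff image_iff)
  qed
  then have "card {f \<in> height_box N. coeff0 f = 0 \<or> coeff4 f = 0}
      \<le> card ((\<lambda>(b, c, d, e). Quartic 0 b c d e) ` ?B \<union> (\<lambda>(a, b, c, d). Quartic a b c d 0) ` ?B)"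
    by (intro card_mono) auto
  also have "\<dots> \<le> card ?B + card ?B"
    by (intro order_trans[OF card_Un_le] add_mono card_image_le) auto
  finally have "real (card {f \<in> height_box N. coeff0 f = 0 \<or> coeff4 f = 0})
      \<le> real (2 * (2 * N + 1) ^ 4)"
    unfolding cardB by linarith
  then show ?thesis
    by (simp add: add.commute)
qed

text \<open>
  Modulo 2 the discriminant is \<open>a * d + b * e + b * c * d\<close>, so it is odd as soon as \<open>a\<close>, \<open>d\<close> are
  odd and \<open>b\<close> is even.
\<close>

lemma card_forms_below_ge:
  assumes "X \<ge> 2"
  shows "(X / 2 - 1) ^ 5 \<le> real (card (forms_below X))"
proof -
  \<comment> \<open>With this \<open>k\<close> every coefficient is at most
    \<open>2 * k - 1\<close>, which is strictly below \<open>X\<close>.\<close>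
  define k where "k = nat \<lfloor>X / 2\<rfloor>"
  let ?I = "{1..int k}"
  let ?B = "?I \<times> ?I \<times> ?I \<times> ?I \<times> ?I"
  let ?q = "\<lambda>(i, j, c, l, e). Quartic (2 * i - 1) (2 * j - 2) c (2 * l - 1) e"
  have k: "real k \<le> X / 2" "X / 2 - 1 \<le> real k"
    using assms unfolding k_def by linarith+
  have "?q ` ?B \<subseteq> forms_below X"
  proof
    fix f assume "f \<in> ?q ` ?B"
    then obtain i j c l e where f: "f = Quartic (2 * i - 1) (2 * j - 2) c (2 * l - 1) e"
      and ijcle: "i \<in> ?I" "j \<in> ?I" "c \<in> ?I" "l \<in> ?I" "e \<in> ?I"
      by auto
    have "odd (discriminant f)"
      unfolding f discriminant_def quartic_discr_def by simp
    then have "discriminant f \<noteq> 0"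
      by auto
    moreover have "quartic_height f \<le> 2 * int k - 1"
      using ijcle by (auto simp: f quartic_height_def)
    then have "real_of_int (quartic_height f) < X"
      using k by linarith
    ultimately show "f \<in> forms_below X"
      by (simp add: forms_below_def)
  qed
  moreover have "inj_on ?q ?B"
    by (auto simp: inj_on_def)
  ultimately have "card ?B \<le> card (forms_below X)"
    by (intro card_inj_on_le[of ?q] finite_forms_below)
  moreover have "card ?B = k ^ 5"
    by (simp add: card_cartesian_product power_numeral_odd power4_eq_xxxx eval_nat_numeral)
  ultimately have "real k ^ 5 \<le> real (card (forms_below X))"
    by (metis of_nat_le_iff of_nat_power)
  moreover have "(X / 2 - 1) ^ 5 \<le> real k ^ 5"
    using k assms by (intro power_mono) auto
  ultimately show ?thesis
    by linarith
qed

text \<open>The saving \<eta> in the exponent enters M^2 twice, giving X^(5 - 2\<eta>) up to the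
  divisor bound. The divisor bound is applied with exponent \<eta>/2 to a^2, where a is at most
  X^(5/4), and so costs X^(5\<eta>/4). What remains is the saving 3\<eta>/4.\<close>

lemma card_small_point_forms_le:
  fixes \<theta> \<eta> :: real
  assumes \<eta>: "0 < \<eta>" "\<eta> \<le> 1 / 5" and \<theta>: "\<theta> = 5 / 4 - \<eta>"
  obtains K where "\<And>X. X \<ge> 1 \<Longrightarrow>
    real (card {f \<in> forms_below X. \<exists>x y z. (x, y, z) \<in> rational_points f \<and>
        weil_height x y < \<theta> * ln (real_of_int (quartic_height f))})
    \<le> K * X ^ 5 * (X powr - (1 / 4) * (ln X + 1) + X powr - (3 / 4 * \<eta>))"
proof -
  obtain C where C: "C > 0"
    "\<And>n::nat. n > 0 \<Longrightarrow> real (card {d. d dvd n}) \<le> C * real n powr (\<eta> / 2)"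
    using divisor_bound[of "\<eta> / 2"] \<eta> by auto
  have \<theta>1: "1 \<le> \<theta>" "\<theta> \<le> 5 / 4"
    using \<eta> \<theta> by auto
  \<comment> \<open>162 = 2 * 3^4 comes from the degenerate forms; the factor 2 from a form and its
    reverse; 180 = 3 * 12 * 5 from the coefficient pairs and the range of the root; 30 = 24 * 5/4
    from the sum over points.\<close>
  define K where "K = 162 + 2 * (180 * C) * 30"
  have main: "real (card {f \<in> forms_below X. \<exists>x y z. (x, y, z) \<in> rational_points f \<and>
        weil_height x y < \<theta> * ln (real_of_int (quartic_height f))})
    \<le> K * X ^ 5 * (X powr - (1 / 4) * (ln X + 1) + X powr - (3 / 4 * \<eta>))" (is "real (card ?Bad) \<le> _")
    if X: "X \<ge> 1" for X
  proof -
    define N M w where "N = nat \<lfloor>X\<rfloor>" and "M = nat \<lfloor>X powr \<theta>\<rfloor>" and "w = nat \<lceil>sqrt (5 * real N)\<rceil>"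
    let ?Z = "{f \<in> height_box N. coeff0 f = 0 \<or> coeff4 f = 0}"
    let ?S = "square_forms N M"
    have N: "real N \<le> X"
      using X by (simp add: N_def)
    have "X powr \<theta> \<ge> 1"
      using X \<theta>1 by (simp add: ge_one_powr_ge_zero)
    then have M: "real M \<le> X powr \<theta>" "M > 0"
      by (auto simp: M_def)
    have "sqrt (5 * real N) \<le> real w"
      by (simp add: w_def)
    then have "(sqrt (5 * real N))\<^sup>2 \<le> (real w)\<^sup>2"
      by (rule power_mono) simp
    then have "real (5 * N) \<le> real (w\<^sup>2)"
      by simp
    then have w: "5 * N \<le> w\<^sup>2"
      by (simp only: of_nat_le_iff)
    have w_le: "real w + 1 \<le> 5 * sqrt X"
    proof -
      have "real w \<le> sqrt (5 * real N) + 1"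
      proof -
        have "- 1 < sqrt (5 * real N)"
          by (rule less_le_trans[of _ 0]) simp_all
        then show ?thesis
          using of_int_ceiling_le_add_one[of "sqrt (5 * real N)"] by (simp add: w_def)
      qed
      also have "sqrt (5 * real N) \<le> sqrt (9 * X)"
        using N X by (intro real_sqrt_le_mono) simp
      also have "\<dots> = 3 * sqrt X"
        by (simp add: real_sqrt_mult)
      finally have "real w \<le> 3 * sqrt X + 1" by simp
      moreover have "sqrt X \<ge> 1"
        using X by simp
      ultimately show ?thesis
        by linarith
    qed
    define D where "D = C * X powr (5 / 4 * \<eta>)"
    have D: "real (card {d. d dvd a\<^sup>2}) \<le> D" if a: "a > 0" "a \<le> M" for a
    proof -
      have "real (card {d. d dvd a\<^sup>2}) \<le> C * real (a\<^sup>2) powr (\<eta> / 2)"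
        using C(2)[of "a\<^sup>2"] a by simp
      also have "real (a\<^sup>2) powr (\<eta> / 2) = real a powr \<eta>"
        using a by (simp add: powr_powr flip: powr_numeral)
      also have "real a powr \<eta> \<le> (X powr \<theta>) powr \<eta>"
        using M a \<eta> by (intro powr_mono2) auto
      also have "\<dots> \<le> X powr (5 / 4 * \<eta>)"
        unfolding powr_powr using X \<theta>1 \<eta> by (intro powr_mono mult_right_mono) auto
      finally show ?thesis
        using C(1) by (simp add: D_def)
    qed
    have "D \<ge> 0"
      using C(1) by (simp add: D_def)
    have lnX: "ln X \<ge> 0"
      using X by simp
    have "real (card ?S) \<le> D * (2 * real N + 1) * (12 * real N) * (real w + 1)
        * (24 * (real N)\<^sup>2 * (ln (real M) + 1) + 6 * (real M)\<^sup>2)"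
      by (rule card_square_forms_le[OF w M(2) D])
    also have "\<dots> \<le> D * (3 * X) * (12 * X) * (5 * sqrt X)
        * (24 * X\<^sup>2 * (5 / 4 * ln X + 1) + 6 * (X powr \<theta>)\<^sup>2)"
    proof -
      have "ln (real M) \<le> ln (X powr \<theta>)"
        using M by (subst ln_le_cancel_iff) auto
      also have "\<dots> \<le> 5 / 4 * ln X"
        using X mult_right_mono[OF \<theta>1(2) lnX] by (simp add: ln_powr)
      finally have "ln (real M) \<le> 5 / 4 * ln X" .
      moreover have "ln (real M) \<ge> 0"
        using M(2) by simp
      moreover have "2 * real N + 1 \<le> 3 * X"
        using N X by simp
      ultimately show ?thesis
        using w_le N M X \<open>D \<ge> 0\<close> lnX
        by (intro mult_mono add_mono power_mono order_refl mult_nonneg_nonneg add_nonneg_nonneg) auto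
    qed
    also have "\<dots> \<le> D * (3 * X) * (12 * X) * (5 * sqrt X)
        * (30 * (X\<^sup>2 * (ln X + 1) + (X powr \<theta>)\<^sup>2))"
    proof (rule mult_left_mono)
      have "24 * X\<^sup>2 * (5 / 4 * ln X + 1) \<le> 30 * (X\<^sup>2 * (ln X + 1))"
        by (simp add: algebra_simps)
      moreover have "6 * (X powr \<theta>)\<^sup>2 \<le> 30 * (X powr \<theta>)\<^sup>2"
        by simp
      ultimately show "24 * X\<^sup>2 * (5 / 4 * ln X + 1) + 6 * (X powr \<theta>)\<^sup>2
          \<le> 30 * (X\<^sup>2 * (ln X + 1) + (X powr \<theta>)\<^sup>2)"
        unfolding distrib_left[of 30] by (rule add_mono)
    qed (use X \<open>D \<ge> 0\<close> in auto)
    also have "\<dots> = 180 * C * 30 * (X powr (5 / 4 * \<eta>) * X * X * sqrt X * X\<^sup>2 * (ln X + 1)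
        + X powr (5 / 4 * \<eta>) * X * X * sqrt X * (X powr \<theta>)\<^sup>2)"
      by (simp add: D_def algebra_simps)
    also have "X powr (5 / 4 * \<eta>) * X * X * sqrt X * X\<^sup>2 = X powr (9 / 2 + 5 / 4 * \<eta>)"
    proof -
      have "X powr (9 / 2 + 5 / 4 * \<eta>) = X powr (5 / 4 * \<eta> + 1 + 1 + 1 / 2 + 2)"
        by simp
      also have "\<dots> = X powr (5 / 4 * \<eta>) * X powr 1 * X powr 1 * X powr (1 / 2) * X powr 2"
        by (simp only: powr_add)
      finally show ?thesis
        using X by (simp add: powr_half_sqrt)
    qed
    \<comment> \<open>This is where \<open>\<eta> \<le> 1 / 5\<close> is used: 9/2 + 5/4 * 1/5
      equals 5 - 1/4.\<close>
    also have "\<dots> \<le> X powr (5 - 1 / 4)"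
      using X \<eta> by (intro powr_mono) auto
    also have "X powr (5 - 1 / 4) = X ^ 5 * X powr - (1 / 4)"
      using X powr_add[of X 5 "- (1 / 4)"] by simp
    also have "X powr (5 / 4 * \<eta>) * X * X * sqrt X * (X powr \<theta>)\<^sup>2 = X ^ 5 * X powr - (3 / 4 * \<eta>)"
    proof -
      have "X powr 5 * X powr - (3 / 4 * \<eta>) = X powr (5 / 4 * \<eta> + 1 + 1 + 1 / 2 + (\<theta> + \<theta>))"
        unfolding powr_add[symmetric] by (rule arg_cong[of _ _ "(powr) X"]) (simp add: \<theta>)
      also have "\<dots> = X powr (5 / 4 * \<eta>) * X powr 1 * X powr 1 * X powr (1 / 2) * (X powr \<theta> * X powr \<theta>)"
        by (simp only: powr_add)
      finally show ?thesis
        using X by (simp add: powr_half_sqrt power2_eq_square)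
    qed
    finally have S: "real (card ?S) \<le> 180 * C * 30 *
        (X ^ 5 * X powr - (1 / 4) * (ln X + 1) + X ^ 5 * X powr - (3 / 4 * \<eta>))"
      using lnX C(1) by (simp add: mult_right_mono)
    have "real (card ?Z) \<le> 2 * (2 * real N + 1) ^ 4"
      by (rule card_degenerate_forms_le)
    also have "\<dots> \<le> 2 * (3 * X) ^ 4"
      using N X by (intro mult_left_mono power_mono) auto
    also have "\<dots> = 162 * X powr 4"
      using X by (simp add: power_mult_distrib)
    also have "\<dots> \<le> 162 * X powr (5 - 1 / 4)"
      using X by (intro mult_left_mono powr_mono) auto
    also have "X powr (5 - 1 / 4) = X ^ 5 * X powr - (1 / 4)"
      using X powr_add[of X 5 "- (1 / 4)"] by simp
    also have "162 * (X ^ 5 * X powr - (1 / 4)) \<le> 162 * (X ^ 5 * X powr - (1 / 4) * (ln X + 1))"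
      using X lnX by (simp add: mult_le_cancel_left1 mult_less_0_iff)
    also have "\<dots> \<le> 162 *
        (X ^ 5 * X powr - (1 / 4) * (ln X + 1) + X ^ 5 * X powr - (3 / 4 * \<eta>))"
      using X by simp
    finally have Z: "real (card ?Z) \<le> 162 *
        (X ^ 5 * X powr - (1 / 4) * (ln X + 1) + X ^ 5 * X powr - (3 / 4 * \<eta>))" .
    have "?Bad \<subseteq> ?Z \<union> (?S \<union> reverse_form ` ?S)"
    proof
      fix f assume "f \<in> ?Bad"
      then show "f \<in> ?Z \<union> (?S \<union> reverse_form ` ?S)"
        unfolding N_def M_def using small_point_imp_square_forms[of f X _ _ _ \<theta>] \<theta>1 by auto
    qed
    then have "card ?Bad \<le> card (?Z \<union> (?S \<union> reverse_form ` ?S))"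
      using finite_height_box finite_square_forms by (intro card_mono) auto
    also have "\<dots> \<le> card ?Z + (card ?S + card ?S)"
      by (intro order_trans[OF card_Un_le] add_mono order_refl card_image_le finite_square_forms)
    finally have "real (card ?Bad) \<le> real (card ?Z) + 2 * real (card ?S)"
      by linarith
    also have "\<dots> \<le> K * (X ^ 5 * X powr - (1 / 4) * (ln X + 1) + X ^ 5 * X powr - (3 / 4 * \<eta>))"
      using Z S unfolding K_def by (simp only: distrib_right)
    also have "\<dots> = K * X ^ 5 * (X powr - (1 / 4) * (ln X + 1) + X powr - (3 / 4 * \<eta>))"
      by (simp add: algebra_simps)
    finally show ?thesis .
  qed
  show ?thesis
    by (rule that[OF main])
qed

section \<open>Passage to density one\<close>

text \<open>The total number of forms is at least (X/2 - 1)^5, of the same order as X^5: the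
  quotient tends to 2^5 = 32, so the proportion of exceptions is governed by
  \<open>r\<close>.\<close>

lemma holds_for_100_percent_if_card_exceptions_le:
  fixes r :: "real \<Rightarrow> real"
  assumes exc: "\<And>X. X \<ge> 1 \<Longrightarrow> real (card {f \<in> forms_below X. \<not> Q f}) \<le> K * X ^ 5 * r X"
    and r: "(r \<longlongrightarrow> 0) at_top"
  shows "holds_for_100_percent Q"
proof -
  let ?t = "\<lambda>X. real (card (forms_below X))"
  let ?b = "\<lambda>X. real (card {f \<in> forms_below X. \<not> Q f})"
  have pos: "?t X > 0" if "X \<ge> 3" for X
  proof -
    have "0 < (X / 2 - 1) ^ 5"
      using that by simp
    then show ?thesis
      using card_forms_below_ge[of X] that by linarith
  qed
  have "((\<lambda>X. ?b X / ?t X) \<longlongrightarrow> 0) at_top"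
  proof (rule tendsto_sandwich)
    show "\<forall>\<^sub>F X in at_top. 0 \<le> ?b X / ?t X"
      by simp
    show "\<forall>\<^sub>F X in at_top. ?b X / ?t X \<le> K * r X * (X ^ 5 / (X / 2 - 1) ^ 5)"
      using eventually_ge_at_top[of 3]
    proof eventually_elim
      case (elim X)
      have "?b X / ?t X \<le> (K * X ^ 5 * r X) / (X / 2 - 1) ^ 5"
        using elim exc[of X] card_forms_below_ge[of X]
        by (intro frac_le) (auto intro: order_trans[OF _ exc[of X]])
      then show ?case
        by (simp add: mult_ac)
    qed
    have "((\<lambda>X::real. X ^ 5 / (X / 2 - 1) ^ 5) \<longlongrightarrow> 32) at_top"
      by real_asymp (simp add: power_divide)
    then have "((\<lambda>X. K * r X * (X ^ 5 / (X / 2 - 1) ^ 5)) \<longlongrightarrow> K * 0 * 32) at_top"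
      by (intro tendsto_intros r)
    then show "((\<lambda>X. K * r X * (X ^ 5 / (X / 2 - 1) ^ 5)) \<longlongrightarrow> 0) at_top"
      by simp
  qed simp
  then have "((\<lambda>X. 1 - ?b X / ?t X) \<longlongrightarrow> 1 - 0) at_top"
    by (intro tendsto_intros)
  moreover have "\<forall>\<^sub>F X in at_top. 1 - ?b X / ?t X = real (card {f \<in> forms_below X. Q f}) / ?t X"
    using eventually_ge_at_top[of 3]
  proof eventually_elim
    case (elim X)
    have "card (forms_below X) = card ({f \<in> forms_below X. Q f} \<union> {f \<in> forms_below X. \<not> Q f})"
      by (rule arg_cong[of _ _ card]) auto
    also have "\<dots> = card {f \<in> forms_below X. Q f} + card {f \<in> forms_below X. \<not> Q f}"
      using finite_forms_below[of X] by (intro card_Un_disjoint) auto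
    finally show ?case
      using pos[OF elim] by (simp add: field_simps)
  qed
  ultimately show ?thesis
    unfolding holds_for_100_percent_def by (auto elim: Lim_transform_eventually)
qed

theorem theorem1p1:
  fixes \<epsilon> :: real
  assumes "\<epsilon> > 0"
  shows "holds_for_100_percent (\<lambda>f. \<forall>x y z. (x, y, z) \<in> rational_points f \<longrightarrow>
           weil_height x y \<ge> (5 / 4 - \<epsilon>) * ln (real_of_int (quartic_height f)))"
proof -
  \<comment> \<open>Heights are at least 1, so their logarithms are nonnegative and the bound for a
    smaller \<eta> implies the one for \<epsilon>. The cap 1/5 meets the restriction of the exponent
    count.\<close>
  define \<eta> where "\<eta> = min \<epsilon> (1 / 5)"
  have \<eta>: "0 < \<eta>" "\<eta> \<le> 1 / 5" "\<eta> \<le> \<epsilon>"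
    using assms by (auto simp: \<eta>_def)
  let ?Q = "\<lambda>f. \<forall>x y z. (x, y, z) \<in> rational_points f \<longrightarrow>
      weil_height x y \<ge> (5 / 4 - \<epsilon>) * ln (real_of_int (quartic_height f))"
  let ?r = "\<lambda>X. X powr - (1 / 4) * (ln X + 1) + X powr - (3 / 4 * \<eta>)"
  let ?Bad = "\<lambda>X. {f \<in> forms_below X. \<exists>x y z. (x, y, z) \<in> rational_points f \<and>
        weil_height x y < (5 / 4 - \<eta>) * ln (real_of_int (quartic_height f))}"
  obtain K where K: "\<And>X. X \<ge> 1 \<Longrightarrow> real (card (?Bad X)) \<le> K * X ^ 5 * ?r X"
    using card_small_point_forms_le[OF \<eta>(1,2) refl] by blast
  show ?thesis
  proof (rule holds_for_100_percent_if_card_exceptions_le[where K = K and r = ?r])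
    fix X :: real assume X: "X \<ge> 1"
    have "{f \<in> forms_below X. \<not> ?Q f} \<subseteq> ?Bad X"
    proof
      fix f assume "f \<in> {f \<in> forms_below X. \<not> ?Q f}"
      then obtain x y z where f: "f \<in> forms_below X" and P: "(x, y, z) \<in> rational_points f"
        and small: "weil_height x y < (5 / 4 - \<epsilon>) * ln (real_of_int (quartic_height f))"
        by auto
      have "quartic_height f \<ge> 1"
        using f by (auto simp: forms_below_def quartic_height_pos)
      then have "(5 / 4 - \<epsilon>) * ln (real_of_int (quartic_height f))
          \<le> (5 / 4 - \<eta>) * ln (real_of_int (quartic_height f))"
        using \<eta> by (intro mult_right_mono) auto
      with small have "weil_height x y < (5 / 4 - \<eta>) * ln (real_of_int (quartic_height f))"
        by linarith
      then show "f \<in> ?Bad X"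
        using f P by blast
    qed
    then have "card {f \<in> forms_below X. \<not> ?Q f} \<le> card (?Bad X)"
      using finite_forms_below[of X] by (intro card_mono) auto
    with K[OF X] show "real (card {f \<in> forms_below X. \<not> ?Q f}) \<le> K * X ^ 5 * ?r X"
      by linarith
  next
    have "((\<lambda>X::real. X powr - (1 / 4) * (ln X + 1)) \<longlongrightarrow> 0) at_top"
      by real_asymp
    moreover have "((\<lambda>X::real. X powr - (3 / 4 * \<eta>)) \<longlongrightarrow> 0) at_top"
      using \<eta> by (intro tendsto_neg_powr filterlim_ident) auto
    ultimately have "(?r \<longlongrightarrow> 0 + 0) at_top"
      by (rule tendsto_add)
    then show "(?r \<longlongrightarrow> 0) at_top"
      by simp
  qed
qed

end
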